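(* Let $D\subset\mathbb{C}^n$ be a central hyperplane arrangement with reduced defining equation $f$ (a product of pairwise non-proportional linear forms), with irreducible components (hyperplanes) $D_i$. For a rational number $\alpha>0$ let $m_\alpha$ be the multiplicity of $\alpha$ as a root of $b_f(-s)$ (with $m_\alpha=0$ if $\alpha$ is not a root), and put $\lambda=\exp(-2\pi i\alpha)$. Then $m_\alpha\le m(\lambda)$. In particular, the set $R_f$ of roots of $b_f(-s)$ satisfies $R_f\subset\bigcup_{L\in\mathcal{DE}(D)}\mathbb{Z}\,m_L^{-1}$, and $m_\alpha=1$ for every $\alpha\in R_f\setminus\mathbb{Z}$ provided $\gcd(m_L,m_{L'})=1$ for all dense edges $L,L'$ of $D$ such that $L\subset L'$ or $L\cap L'$ is nondense.
   Context: $b_f(s)$ is the Bernstein–Sato polynomial: the monic polynomial of lowest degree with $b_f(s)f^s=Pf^{s+1}$ for some $P\in\mathcal{D}_X[s]$. An edge of $D$ is a nonempty intersection of some of the hyperplanes $D_i$ (a linear subspace; each $D_i$ itself is an edge). For an edge $L$, let $m_L$ be the number of $D_i$ containing $L$. A central arrangement in a vector space $W$ is decomposable if there is a nontrivial decomposition $W=W'\times W''$ such that the arrangement is the union of pull-backs of arrangements on $W'$ and on $W''$; otherwise indecomposable. An edge $L$ is dense if the arrangement formed by the hyperplanes $D_i\supset L$, viewed as an arrangement in $\mathbb{C}^n/L$, is indecomposable. $\mathcal{DE}(D)$ is the set of dense edges. For $\lambda\in\mathbb{C}$, $\mathcal{DE}(D,\lambda)=\{L\in\mathcal{DE}(D):\lambda^{m_L}=1\}$.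 Two elements $L,L'\in\mathcal{DE}(D,\lambda)$ are strongly adjacent if $L\subset L'$, or $L\supset L'$, or $L\cap L'$ is not a dense edge. $m(\lambda)$ is the maximal cardinality of a subset $S\subset\mathcal{DE}(D,\lambda)$ any two elements of which are strongly adjacent. *)

theory Defs
  imports "HOL-Library.Poly_Mapping" "HOL-Computational_Algebra.Polynomial" Complex_Main
begin

text \<open>Variables: Some j is the coordinate x_j (j :: 'n), None is the parameter s.
  Polynomials in C[x,s] are finitely supported maps from monomials to coefficients.\<close>

type_synonym 'n mpoly = "('n option \<Rightarrow>\<^sub>0 nat) \<Rightarrow>\<^sub>0 complex"

definition mvar :: "'v \<Rightarrow> ('v \<Rightarrow>\<^sub>0 nat) \<Rightarrow>\<^sub>0 complex" where
  "mvar v = Poly_Mapping.single (Poly_Mapping.single v 1) 1"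

definition mconst :: "complex \<Rightarrow> ('v \<Rightarrow>\<^sub>0 nat) \<Rightarrow>\<^sub>0 complex" where
  "mconst c = Poly_Mapping.single 0 c"

definition pd :: "'v \<Rightarrow> (('v \<Rightarrow>\<^sub>0 nat) \<Rightarrow>\<^sub>0 complex) \<Rightarrow> (('v \<Rightarrow>\<^sub>0 nat) \<Rightarrow>\<^sub>0 complex)" where
  "pd v p = (\<Sum>m\<in>Poly_Mapping.keys p. Poly_Mapping.single (m - Poly_Mapping.single v 1)
                                (of_nat (Poly_Mapping.lookup m v) * Poly_Mapping.lookup p m))"

definition mpoly_of_spoly :: "complex poly \<Rightarrow> 'n mpoly" where
  "mpoly_of_spoly b = (\<Sum>j\<le>degree b. Poly_Mapping.single (Poly_Mapping.single None j) (coeff b j))"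

text \<open>A pair (g,k) represents the element g * f^(s-k).  The derivation d/dx_i acts by
  d_i(g f^(s-k)) = (f * d_i g + (s-k) * g * d_i f) f^(s-k-1).\<close>
definition dstep :: "'n mpoly \<Rightarrow> 'n \<Rightarrow> 'n mpoly \<times> nat \<Rightarrow> 'n mpoly \<times> nat" where
  "dstep f i gk = (case gk of (g, k) \<Rightarrow>
     (f * pd (Some i) g + (mvar None - of_nat k) * g * pd (Some i) f, Suc k))"

definition dword :: "'n mpoly \<Rightarrow> 'n list \<Rightarrow> 'n mpoly \<times> nat \<Rightarrow> 'n mpoly \<times> nat" where
  "dword f ws gk = foldr (dstep f) ws gk"

text \<open>An element of D_X[s] is a finite sum of terms c(x,s) * d_i1...d_ir, given as a list of
  (coefficient, word).  The element f^(s+1) is represented by (f, 0).\<close>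
definition apply_op :: "'n mpoly \<Rightarrow> ('n mpoly \<times> 'n list) list \<Rightarrow> ('n mpoly \<times> nat) list" where
  "apply_op f P = map (\<lambda>(c, ws). (case dword f ws (f, 0) of (g, k) \<Rightarrow> (c * g, k))) P"

text \<open>b(s) f^s = P f^(s+1), compared after clearing denominators.\<close>
definition bs_equation :: "'n mpoly \<Rightarrow> complex poly \<Rightarrow> ('n mpoly \<times> 'n list) list \<Rightarrow> bool" where
  "bs_equation f b P \<longleftrightarrow> (\<exists>K. (\<forall>(h, k)\<in>set (apply_op f P). k \<le> K) \<and>
      (\<Sum>(h, k)\<leftarrow>apply_op f P. h * f ^ (K - k)) = mpoly_of_spoly b * f ^ K)"

definition is_b_function :: "'n mpoly \<Rightarrow> complex poly \<Rightarrow> bool" where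
  "is_b_function f b \<longleftrightarrow> (\<exists>P. bs_equation f b P)"

definition bernstein_sato :: "'n mpoly \<Rightarrow> complex poly" where
  "bernstein_sato f = (THE b. lead_coeff b = 1 \<and> is_b_function f b \<and>
      (\<forall>b'. b' \<noteq> 0 \<and> is_b_function f b' \<longrightarrow> degree b \<le> degree b'))"

definition linform :: "('n::finite \<Rightarrow> complex) \<Rightarrow> 'n mpoly" where
  "linform a = (\<Sum>j\<in>UNIV. mconst (a j) * mvar (Some j))"

definition defeq :: "('n::finite \<Rightarrow> complex) list \<Rightarrow> 'n mpoly" where
  "defeq as = (\<Prod>a\<leftarrow>as. linform a)"

definition hyp :: "('n::finite \<Rightarrow> complex) \<Rightarrow> ('n \<Rightarrow> complex) set" where
  "hyp a = {x. (\<Sum>j\<in>UNIV. a j * x j) = 0}"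

definition is_edge :: "('n::finite \<Rightarrow> complex) list \<Rightarrow> ('n \<Rightarrow> complex) set \<Rightarrow> bool" where
  "is_edge as L \<longleftrightarrow> (\<exists>S. S \<noteq> {} \<and> S \<subseteq> {..<length as} \<and> L = (\<Inter>i\<in>S. hyp (as ! i)))"

definition mult :: "('n::finite \<Rightarrow> complex) list \<Rightarrow> ('n \<Rightarrow> complex) set \<Rightarrow> nat" where
  "mult as L = card {i. i < length as \<and> L \<subseteq> hyp (as ! i)}"

definition csubspace :: "('n \<Rightarrow> complex) set \<Rightarrow> bool" where
  "csubspace U \<longleftrightarrow> (\<lambda>_. 0) \<in> U \<and> (\<forall>x\<in>U. \<forall>y\<in>U. (\<lambda>j. x j + y j) \<in> U) \<and>
                   (\<forall>c. \<forall>x\<in>U. (\<lambda>j. c * x j) \<in> U)"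

text \<open>The arrangement of hyperplanes containing L, viewed in C^n/L, is decomposable:
  C^n/L = U/L x V/L nontrivially, each such hyperplane being a pull-back from U/L
  (i.e. containing V) or from V/L (i.e. containing U).\<close>
definition decomposable_at :: "('n::finite \<Rightarrow> complex) list \<Rightarrow> ('n \<Rightarrow> complex) set \<Rightarrow> bool" where
  "decomposable_at as L \<longleftrightarrow> (\<exists>U V. csubspace U \<and> csubspace V \<and> L \<subset> U \<and> L \<subset> V \<and>
      U \<inter> V = L \<and> {(\<lambda>j. u j + v j) | u v. u \<in> U \<and> v \<in> V} = UNIV \<and>
      (\<forall>i<length as. L \<subseteq> hyp (as ! i) \<longrightarrow> U \<subseteq> hyp (as ! i) \<or> V \<subseteq> hyp (as ! i)))"

definition dense_edges :: "('n::finite \<Rightarrow> complex) list \<Rightarrow> ('n \<Rightarrow> complex) set set" where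
  "dense_edges as = {L. is_edge as L \<and> \<not> decomposable_at as L}"

definition dense_edges_lam :: "('n::finite \<Rightarrow> complex) list \<Rightarrow> complex \<Rightarrow> ('n \<Rightarrow> complex) set set" where
  "dense_edges_lam as lam = {L \<in> dense_edges as. lam ^ mult as L = 1}"

definition strongly_adjacent :: "('n::finite \<Rightarrow> complex) list \<Rightarrow> ('n \<Rightarrow> complex) set \<Rightarrow> ('n \<Rightarrow> complex) set \<Rightarrow> bool" where
  "strongly_adjacent as L L' \<longleftrightarrow> L \<subseteq> L' \<or> L' \<subseteq> L \<or> L \<inter> L' \<notin> dense_edges as"

definition m_lam :: "('n::finite \<Rightarrow> complex) list \<Rightarrow> complex \<Rightarrow> nat" where
  "m_lam as lam = Max (card ` {S. S \<subseteq> dense_edges_lam as lam \<and>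
       (\<forall>L\<in>S. \<forall>L'\<in>S. L \<noteq> L' \<longrightarrow> strongly_adjacent as L L')})"

end

theory Submission
  imports Defs "HOL-Computational_Algebra.Computational_Algebra" "HOL-Library.Function_Algebras"
begin

text \<open>By induction over the flats L, the product f_L of the forms vanishing on L has a b-function
  whose multiplicity at z is at most the size of a strongly adjacent family of dense edges
  containing L, all belonging to lambda = exp(2 pi i z).  If L is decomposable, f_L is a product in
  separate variables, b-functions multiply, and the families of the two factors unite.  If L is
  dense, let b0 be the least common multiple of the b-functions of the larger flats.  Localizing,
  b0 * f_L^s lies in D[s] f_L^(s+1) after multiplication by powers of the forms not vanishing
  on L', for each larger flat L', hence after multiplication by all monomials of high degree in
  coordinates transversal to L.  The Euler field lowers that degree one by one at the cost of
  factors d*s + r + k with d = m_L and r = codim L.  These have distinct roots z, and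
  lambda^d = 1 there, so they raise the multiplicity by at most one, accounted for by adding L to
  the family.\<close>

section \<open>Derivations and submodules generated by a power\<close>

text \<open>Only some nonzero element of the ideal of b-functions is constructed, since the
  Bernstein-Sato polynomial divides all of them; what has to be controlled is how orders of roots
  and families grow together. A least common multiple costs nothing: its order at z is attained by
  the polynomial of one larger flat, so the family of that flat suffices. A product over all larger
  flats would add up families that need not be adjacent to one another. For decomposable L the
  orders do add. An edge E above one factor and an edge F above the other meet in a subspace that E
  and F themselves decompose; it is not dense, which is the alternative of strong adjacency that is
  no inclusion. For dense L the exponents lost by localizing are not controlled, but they only
  lengthen the string of Euler factors. Its shape comes from sum d_i y_i = r + sum y_i d_i, where
  the Euler field multiplies f_L^s by d*s and a monomial of degree k by k. The roots -(r+k)/d are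
  simple for a string of any length. The induction follows roots z of b itself; alpha is a root of
  b(-s), so z = -alpha and exp(2 pi i z) is the lambda of the theorem.\<close>

definition derivation :: "('r::comm_ring_1 \<Rightarrow> 'r) \<Rightarrow> bool" where
  "derivation d \<longleftrightarrow> (\<forall>a b. d (a + b) = d a + d b) \<and> (\<forall>a b. d (a * b) = d a * b + a * d b)"

lemma derivation_add: "derivation d \<Longrightarrow> d (a + b) = d a + d b"
  and derivation_mult: "derivation d \<Longrightarrow> d (a * b) = d a * b + a * d b"
  by (simp_all add: derivation_def)

lemma derivation_0: "derivation d \<Longrightarrow> d 0 = 0"
  using derivation_add[of d 0 0] by simp

lemma derivation_1: "derivation d \<Longrightarrow> d 1 = 0"
  using derivation_mult[of d 1 1] by simp

lemma derivation_minus: "derivation d \<Longrightarrow> d (- a) = - d a"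
  using derivation_add[of d a "- a"] derivation_0[of d] by (simp add: eq_neg_iff_add_eq_0 add.commute)

lemma derivation_diff: "derivation d \<Longrightarrow> d (a - b) = d a - d b"
  using derivation_add[of d a "- b"] derivation_minus[of d b] by simp

lemma derivation_of_nat: "derivation d \<Longrightarrow> d (of_nat k) = 0"
  by (induction k) (simp_all add: derivation_0 derivation_1 derivation_add)

lemma derivation_power: "derivation d \<Longrightarrow> d (a ^ Suc k) = of_nat (Suc k) * a ^ k * d a"
proof (induction k)
  case 0
  then show ?case by simp
next
  case (Suc k)
  have "d (a ^ Suc (Suc k)) = d (a * a ^ Suc k)" by simp
  also have "\<dots> = d a * a ^ Suc k + a * d (a ^ Suc k)" by (rule derivation_mult[OF Suc.prems])
  also have "\<dots> = d a * a ^ Suc k + a * (of_nat (Suc k) * a ^ k * d a)"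
    using Suc by simp
  finally show ?case by (simp add: algebra_simps)
qed

lemma derivation_sum: "derivation d \<Longrightarrow> d (\<Sum>i\<in>I. g i) = (\<Sum>i\<in>I. d (g i))"
  by (induction I rule: infinite_finite_induct) (simp_all add: derivation_0 derivation_add)

lemma derivation_lincomb:
  assumes "\<And>i. i \<in> I \<Longrightarrow> derivation (d i)"
  shows "derivation (\<lambda>p. \<Sum>i\<in>I. c i * d i p)"
  unfolding derivation_def
proof (intro conjI allI)
  fix a b
  show "(\<Sum>i\<in>I. c i * d i (a + b)) = (\<Sum>i\<in>I. c i * d i a) + (\<Sum>i\<in>I. c i * d i b)"
    unfolding sum.distrib[symmetric]
    by (rule sum.cong) (simp_all add: derivation_add[OF assms] algebra_simps)
  show "(\<Sum>i\<in>I. c i * d i (a * b)) = (\<Sum>i\<in>I. c i * d i a) * b + a * (\<Sum>i\<in>I. c i * d i b)"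
    unfolding sum.distrib[symmetric] sum_distrib_left sum_distrib_right
    by (rule sum.cong) (simp_all add: derivation_mult[OF assms] algebra_simps)
qed

lemma derivation_eigen_power:
  assumes "derivation E" "E y = y"
  shows "E (y ^ k) = of_nat k * y ^ k"
proof (cases k)
  case 0
  then show ?thesis using assms by (simp add: derivation_1)
next
  case (Suc m)
  then show ?thesis using derivation_power[OF assms(1), of y m] assms(2)
    by (simp add: algebra_simps)
qed

lemma derivation_eigen_prod:
  assumes "derivation E" "\<And>i. i \<in> I \<Longrightarrow> E (y i) = y i"
  shows "E (\<Prod>i\<in>I. y i ^ e i) = of_nat (\<Sum>i\<in>I. e i) * (\<Prod>i\<in>I. y i ^ e i)"
  using assms(2)
proof (induction I rule: infinite_finite_induct)
  case (insert x F)
  then have "E (\<Prod>i\<in>F. y i ^ e i) = of_nat (\<Sum>i\<in>F. e i) * (\<Prod>i\<in>F. y i ^ e i)" by simp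
  moreover have "E (y x ^ e x) = of_nat (e x) * y x ^ e x"
    using insert.prems by (intro derivation_eigen_power[OF assms(1)]) simp
  ultimately show ?case using insert.hyps derivation_mult[OF assms(1)]
    by (simp add: algebra_simps)
qed (simp_all add: derivation_1[OF assms(1)])

text \<open>As in the definition of dstep, the pair (g, k) stands for g * f^(s-k); the set below
  is the module generated by f^(s+1) under multiplications and the derivations in D.
  The last two rules identify (g, k) with (g * f, k + 1).\<close>

inductive_set fsmod :: "('r::comm_ring_1 \<Rightarrow> 'r) set \<Rightarrow> 'r \<Rightarrow> 'r \<Rightarrow> ('r \<times> nat) set"
  for D s f where
  gen: "(f, 0) \<in> fsmod D s f"
| diff: "d \<in> D \<Longrightarrow> (g, k) \<in> fsmod D s f \<Longrightarrow>
    (f * d g + (s - of_nat k) * g * d f, Suc k) \<in> fsmod D s f"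
| scale: "(g, k) \<in> fsmod D s f \<Longrightarrow> (c * g, k) \<in> fsmod D s f"
| add: "(g, k) \<in> fsmod D s f \<Longrightarrow> (h, k) \<in> fsmod D s f \<Longrightarrow> (g + h, k) \<in> fsmod D s f"
| raise: "(g, k) \<in> fsmod D s f \<Longrightarrow> (g * f, Suc k) \<in> fsmod D s f"
| lower: "(g * f, Suc k) \<in> fsmod D s f \<Longrightarrow> (g, k) \<in> fsmod D s f"

lemma fsmod_scale_right: "(g, k) \<in> fsmod D s f \<Longrightarrow> (g * c, k) \<in> fsmod D s f"
  by (metis fsmod.scale mult.commute)

lemma fsmod_minus: "(g, k) \<in> fsmod D s f \<Longrightarrow> (h, k) \<in> fsmod D s f \<Longrightarrow> (g - h, k) \<in> fsmod D s f"
  using fsmod.add[of g k D s f "(-1) * h"] fsmod.scale[of h k D s f "-1"] by simp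

lemma fsmod_0: "(0, k) \<in> fsmod D s f"
proof (induction k)
  case 0
  then show ?case using fsmod.scale[OF fsmod.gen, of 0] by simp
next
  case (Suc k)
  then show ?case using fsmod.raise[OF Suc] by simp
qed

lemma fsmod_sum:
  "(\<And>i. i \<in> I \<Longrightarrow> (g i, k) \<in> fsmod D s f) \<Longrightarrow> ((\<Sum>i\<in>I. g i), k) \<in> fsmod D s f"
  by (induction I rule: infinite_finite_induct) (simp_all add: fsmod_0 fsmod.add)

text \<open>Where g is invertible, multiplication by g^s carries the module of f^s to that of
  (f*g)^s. Only finitely many derivations enter an element, and each costs two more factors g, so a
  power of g clears all denominators.\<close>

lemma fsmod_localize:
  assumes D: "\<And>d. d \<in> D \<Longrightarrow> derivation d"
    and mem: "(w, k) \<in> fsmod D s f"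
  shows "\<exists>M. (g ^ M * w, k) \<in> fsmod D s (f * g)"
  using mem
proof (induction rule: fsmod.induct)
  case gen
  show ?case using fsmod.gen[of "f * g" D s] by (intro exI[of _ 1]) (simp add: mult.commute)
next
  case (diff d w k)
  then obtain M where M: "(g ^ M * w, k) \<in> fsmod D s (f * g)" by blast
  have d: "derivation d" using D diff.hyps by blast
  let ?t = "f * d w + (s - of_nat k) * w * d f"
  have M1: "(g ^ Suc M * w, k) \<in> fsmod D s (f * g)"
    using fsmod.scale[OF M, of g] by (simp add: mult_ac)
  have "(f * g * d (g ^ Suc M * w) + (s - of_nat k) * (g ^ Suc M * w) * d (f * g), Suc k)
      \<in> fsmod D s (f * g)"
    by (rule fsmod.diff[OF diff.hyps(1) M1])
  also have "f * g * d (g ^ Suc M * w) + (s - of_nat k) * (g ^ Suc M * w) * d (f * g)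
      = g ^ (M + 2) * ?t + (g ^ M * w) * (f * g) * ((s - of_nat k + of_nat (Suc M)) * d g)"
    by (simp only: derivation_mult[OF d] derivation_power[OF d]) (simp add: algebra_simps)
  finally have *: "(g ^ (M + 2) * ?t + (g ^ M * w) * (f * g) * ((s - of_nat k + of_nat (Suc M)) * d g), Suc k)
      \<in> fsmod D s (f * g)" .
  \<comment> \<open>The error term from differentiating powers of g. The extra factor g in
    \<open>M1\<close> makes it a multiple of \<open>g ^ M * w\<close> raised one level, so it
    already lies in the module and can be subtracted.\<close>
  have "((g ^ M * w) * (f * g) * ((s - of_nat k + of_nat (Suc M)) * d g), Suc k) \<in> fsmod D s (f * g)"
    by (rule fsmod_scale_right[OF fsmod.raise[OF M]])
  from fsmod_minus[OF * this] show ?case by (intro exI[of _ "M + 2"]) simp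
next
  case (scale w k c)
  then obtain M where "(g ^ M * w, k) \<in> fsmod D s (f * g)" by blast
  from fsmod.scale[OF this, of c] show ?case by (intro exI[of _ M]) (simp add: mult_ac)
next
  case (add w k v)
  then obtain M N where "(g ^ M * w, k) \<in> fsmod D s (f * g)" "(g ^ N * v, k) \<in> fsmod D s (f * g)"
    by blast
  from fsmod.add[OF fsmod.scale[OF this(1), of "g ^ N"] fsmod.scale[OF this(2), of "g ^ M"]]
  show ?case by (intro exI[of _ "M + N"]) (simp add: algebra_simps power_add)
next
  case (raise w k)
  then obtain M where "(g ^ M * w, k) \<in> fsmod D s (f * g)" by blast
  from fsmod.raise[OF this] show ?case by (intro exI[of _ "Suc M"]) (simp add: mult_ac)
next
  case (lower w k)
  then obtain M where "(g ^ M * (w * f), Suc k) \<in> fsmod D s (f * g)" by blast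
  from fsmod.scale[OF this, of g] have "(g ^ M * w * (f * g), Suc k) \<in> fsmod D s (f * g)"
    by (simp add: mult_ac)
  from fsmod.lower[OF this] show ?case by blast
qed

text \<open>Since e kills f and s, it acts on g * f^(s-k) through g alone, and since it commutes
  with \<open>D\<close> it passes through every generation rule, although e itself need not belong
  to \<open>D\<close>.\<close>

lemma fsmod_apply_annihilator:
  assumes D: "\<And>d. d \<in> D \<Longrightarrow> derivation d" and e: "derivation e" "e f = 0" "e s = 0"
    and comm: "\<And>d p. d \<in> D \<Longrightarrow> e (d p) = d (e p)"
    and mem: "(g, k) \<in> fsmod D s f"
  shows "(e g, k) \<in> fsmod D s f"
  using mem
proof (induction rule: fsmod.induct)
  case gen
  then show ?case by (simp add: e fsmod_0)
next
  case (diff d g k)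
  have "e (f * d g + (s - of_nat k) * g * d f) = f * d (e g) + (s - of_nat k) * e g * d f"
    using comm[OF diff.hyps(1)] derivation_0[OF D[OF diff.hyps(1)]] e
    by (simp add: derivation_add derivation_mult derivation_diff derivation_of_nat)
  then show ?case using fsmod.diff[OF diff.hyps(1) diff.IH] by simp
next
  case (scale g k c)
  then show ?case by (simp add: derivation_mult[OF e(1)] fsmod.add fsmod.scale)
next
  case (add g k h)
  then show ?case by (simp add: derivation_add[OF e(1)] fsmod.add)
next
  case (raise g k)
  then show ?case using fsmod.raise[of "e g" k D s f] by (simp add: derivation_mult[OF e(1)] e)
next
  case (lower g k)
  then show ?case using fsmod.lower[of "e g" f k D s] by (simp add: derivation_mult[OF e(1)] e)
qed

text \<open>With d' = d + e, the derivative of g * f^(s-k) along d' differs from that along d by e g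
  * f^(s-k), which stays in the smaller module. This removes from the operator the directions along
  which f is constant.\<close>

lemma fsmod_drop_annihilators:
  assumes D: "\<And>d. d \<in> D \<Longrightarrow> derivation d"
    and split: "\<And>d'. d' \<in> D' \<Longrightarrow> \<exists>d\<in>D. \<exists>e. derivation e \<and> e f = 0 \<and> e s = 0 \<and>
        (\<forall>d\<in>D. \<forall>p. e (d p) = d (e p)) \<and> (\<forall>p. d' p = d p + e p)"
    and mem: "(g, k) \<in> fsmod D' s f"
  shows "(g, k) \<in> fsmod D s f"
  using mem
proof (induction rule: fsmod.induct)
  case (diff d' g k)
  from split[OF diff.hyps(1)] obtain d e where de: "d \<in> D" "derivation e" "e f = 0" "e s = 0"
    "\<And>d p. d \<in> D \<Longrightarrow> e (d p) = d (e p)" "\<And>p. d' p = d p + e p" by blast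
  have "(e g * f, Suc k) \<in> fsmod D s f"
    using fsmod_apply_annihilator[of D e f s g k] D de diff.IH by (blast intro: fsmod.raise)
  from fsmod.add[OF fsmod.diff[OF de(1) diff.IH] this]
  show ?case by (simp add: de(3,6) algebra_simps)
qed (blast intro: fsmod.intros)+

text \<open>The derivations in \<open>D\<close> treat c * f2^s as a constant, so an operator taking
  f1^(s+1) to w * f1^(s-k) takes c * f1^(s+1) * f2^s to c * w * f1^(s-k) * f2^s. The factor
  \<open>f2 ^ k\<close> rewrites the result in terms of (f1*f2)^(s-k).\<close>

lemma fsmod_twist:
  assumes D: "\<And>d. d \<in> D \<Longrightarrow> derivation d \<and> d f2 = 0 \<and> d c = 0" and sub: "D \<subseteq> D'"
    and gen: "(c * f1, 0) \<in> fsmod D' s (f1 * f2)"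
    and mem: "(w, k) \<in> fsmod D s f1"
  shows "(c * w * f2 ^ k, k) \<in> fsmod D' s (f1 * f2)"
  using mem
proof (induction rule: fsmod.induct)
  case gen
  then show ?case using assms(3) by simp
next
  case (diff d w k)
  have d: "derivation d" "d f2 = 0" "d c = 0" using D diff.hyps by auto
  have pow: "d (f2 ^ k) = 0"
    by (cases k) (use d in \<open>simp_all del: power_Suc add: derivation_1 derivation_power\<close>)
  have "(f1 * f2 * d (c * w * f2 ^ k) + (s - of_nat k) * (c * w * f2 ^ k) * d (f1 * f2), Suc k)
      \<in> fsmod D' s (f1 * f2)"
    using diff sub by (intro fsmod.diff) auto
  also have "f1 * f2 * d (c * w * f2 ^ k) + (s - of_nat k) * (c * w * f2 ^ k) * d (f1 * f2)
      = c * (f1 * d w + (s - of_nat k) * w * d f1) * f2 ^ Suc k"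
    by (simp add: derivation_mult[OF d(1)] d pow algebra_simps)
  finally show ?case .
next
  case (scale w k a)
  from fsmod.scale[OF scale.IH, of a] show ?case by (simp add: mult_ac)
next
  case (add w k v)
  from fsmod.add[OF add.IH] show ?case by (simp add: algebra_simps)
next
  case (raise w k)
  from fsmod.raise[OF raise.IH] show ?case by (simp add: mult_ac)
next
  case (lower w k)
  then have "(c * w * f2 ^ k * (f1 * f2), Suc k) \<in> fsmod D' s (f1 * f2)" by (simp add: mult_ac)
  then show ?case by (rule fsmod.lower)
qed

text \<open>Two twists: with constant f2 the generator (f1*f2)^(s+1) goes to b1 * f1^s * f2^(s+1),
  and then, with the roles exchanged and constant b1, to b1 * b2 * (f1*f2)^s.\<close>

lemma fsmod_product:
  assumes D1: "\<And>d. d \<in> D1 \<Longrightarrow> derivation d \<and> d f2 = 0"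
    and D2: "\<And>d. d \<in> D2 \<Longrightarrow> derivation d \<and> d f1 = 0 \<and> d b1 = 0"
    and sub: "D1 \<subseteq> D" "D2 \<subseteq> D"
    and b: "(b1, 0) \<in> fsmod D1 s f1" "(b2, 0) \<in> fsmod D2 s f2"
  shows "(b1 * b2, 0) \<in> fsmod D s (f1 * f2)"
proof -
  have "(f2 * b1 * f2 ^ 0, 0) \<in> fsmod D s (f1 * f2)"
    using D1 sub fsmod.gen[of "f1 * f2" D s] b
    by (intro fsmod_twist[where D = D1]) (auto simp: mult.commute)
  then have "(b1 * f2, 0) \<in> fsmod D s (f2 * f1)" by (simp add: mult.commute)
  then have "(b1 * b2 * f1 ^ 0, 0) \<in> fsmod D s (f2 * f1)"
    using D2 sub b by (intro fsmod_twist[where D = D2]) auto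
  then show ?thesis by (simp add: mult.commute)
qed

text \<open>Differentiate each y_i * p * f^s along v_i and sum: the product rule gives
  \<open>card B\<close> from the v_i y_i, k from the degree of p, and d*s from the degree of
  f.\<close>

lemma fsmod_euler:
  assumes D: "\<And>i. i \<in> B \<Longrightarrow> v i \<in> D \<and> derivation (v i)"
    and dual: "\<And>i. i \<in> B \<Longrightarrow> v i (y i) = 1"
    and f: "(\<Sum>i\<in>B. y i * v i f) = of_nat d * f"
    and p: "(\<Sum>i\<in>B. y i * v i p) = of_nat k * p"
    and mem: "\<And>i. i \<in> B \<Longrightarrow> (y i * p, 0) \<in> fsmod D s f"
  shows "((of_nat d * s + of_nat (card B + k)) * p, 0) \<in> fsmod D s f"
proof -
  have "(\<Sum>i\<in>B. f * v i (y i * p) + (s - of_nat 0) * (y i * p) * v i f, Suc 0) \<in> fsmod D s f"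
    by (intro fsmod_sum fsmod.diff mem) (use D in auto)
  also have "(\<Sum>i\<in>B. f * v i (y i * p) + (s - of_nat 0) * (y i * p) * v i f)
      = (\<Sum>i\<in>B. f * p + f * (y i * v i p) + s * p * (y i * v i f))"
    using D by (intro sum.cong) (simp_all add: derivation_mult dual algebra_simps)
  also have "\<dots> = of_nat (card B) * (f * p) + f * (\<Sum>i\<in>B. y i * v i p) + s * p * (\<Sum>i\<in>B. y i * v i f)"
    by (simp add: sum.distrib sum_distrib_left)
  also have "\<dots> = (of_nat d * s + of_nat (card B + k)) * p * f"
    by (simp add: f p algebra_simps)
  finally show ?thesis by (simp add: fsmod.lower)
qed

text \<open>Descending the degree of the monomials in the y i by one with each Euler factor.\<close>

lemma fsmod_euler_descent:
  assumes B: "finite B" and D: "\<And>i. i \<in> B \<Longrightarrow> v i \<in> D \<and> derivation (v i)"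
    and dual: "\<And>i j. i \<in> B \<Longrightarrow> j \<in> B \<Longrightarrow> v i (y j) = (if i = j then 1 else 0)"
    and f: "(\<Sum>i\<in>B. y i * v i f) = of_nat d * f"
    and const: "\<And>i. i \<in> B \<Longrightarrow> v i b = 0" "\<And>i. i \<in> B \<Longrightarrow> v i s = 0"
    and mem: "\<And>i. i \<in> B \<Longrightarrow> \<exists>M. (y i ^ M * b, 0) \<in> fsmod D s f"
  shows "\<exists>T. (b * (\<Prod>k<T. of_nat d * s + of_nat (card B + k)), 0) \<in> fsmod D s f"
proof -
  define E where "E = (\<lambda>p. \<Sum>i\<in>B. y i * v i p)"
  have E: "derivation E" unfolding E_def using D by (intro derivation_lincomb) auto
  have Ey: "E (y i) = y i" if "i \<in> B" for i
    unfolding E_def using that B by (simp add: dual sum.delta' if_distrib cong: if_cong)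
  have Econst: "E c = 0" if "\<And>i. i \<in> B \<Longrightarrow> v i c = 0" for c
    unfolding E_def by (simp add: that)
  obtain N where N: "\<And>i. i \<in> B \<Longrightarrow> (y i ^ N i * b, 0) \<in> fsmod D s f"
    using mem by metis
  define M where "M = (\<Sum>i\<in>B. N i)"
  have M: "(y i ^ m * b, 0) \<in> fsmod D s f" if "i \<in> B" "M \<le> m" for i m
  proof -
    have "N i \<le> M" unfolding M_def using that B by (intro member_le_sum) auto
    then have "y i ^ m = y i ^ (m - N i) * y i ^ N i" using that by (simp flip: power_add)
    then show ?thesis using fsmod.scale[OF N[OF that(1)], of "y i ^ (m - N i)"] by (simp add: mult_ac)
  qed
  \<comment> \<open>Pigeonhole: a monomial of total degree T has some exponent at least M, hence
    contains a power already known to lie in the module.\<close>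
  define T where "T = card B * M + 1"
  \<comment> \<open>The Euler factors paid in descending from degree T to degree k: none at k = T,
    all of them at k = 0.\<close>
  define c where "c k = (\<Prod>j\<in>{k..<T}. of_nat d * s + of_nat (card B + j))" for k
  have "\<forall>e. (\<Sum>i\<in>B. e i) = k \<longrightarrow> ((\<Prod>i\<in>B. y i ^ e i) * (b * c k), 0) \<in> fsmod D s f"
    if "k \<le> T" for k
    using that
  proof (induction k rule: inc_induct)
    case base
    show ?case
    proof (intro allI impI)
      fix e :: "_ \<Rightarrow> nat" assume e: "(\<Sum>i\<in>B. e i) = T"
      have "\<exists>i\<in>B. M \<le> e i"
      proof (rule ccontr)
        assume "\<not> (\<exists>i\<in>B. M \<le> e i)"
        then have "(\<Sum>i\<in>B. e i) \<le> of_nat (card B) * M" by (intro sum_bounded_above) auto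
        then show False using e by (simp add: T_def)
      qed
      then obtain i where i: "i \<in> B" "M \<le> e i" by blast
      have "(\<Prod>i\<in>B. y i ^ e i) * (b * c T) = (\<Prod>i\<in>B - {i}. y i ^ e i) * (y i ^ e i * b)"
        using i B by (simp add: prod.remove[of B i] c_def mult_ac)
      then show "((\<Prod>i\<in>B. y i ^ e i) * (b * c T), 0) \<in> fsmod D s f"
        using fsmod.scale[OF M[OF i]] by simp
    qed
  next
    case (step k)
    show ?case
    proof (intro allI impI)
      fix e :: "_ \<Rightarrow> nat" assume e: "(\<Sum>i\<in>B. e i) = k"
      define p where "p = (\<Prod>i\<in>B. y i ^ e i) * (b * c (Suc k))"
      \<comment> \<open>Both b and the Euler factors involve s only and are constant along the v i,
        so p has the same Euler degree k as its monomial.\<close>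
      have v: "v i (b * c (Suc k)) = 0" if "i \<in> B" for i
      proof -
        have d: "derivation (v i)" using D that by blast
        have "v i (\<Prod>j\<in>J. of_nat d * s + of_nat (card B + j)) = 0" for J :: "nat set"
          by (induction J rule: infinite_finite_induct)
            (simp_all add: derivation_mult[OF d] derivation_add[OF d] derivation_1[OF d]
              derivation_of_nat[OF d] const that)
        then show ?thesis by (simp add: c_def derivation_mult[OF d] const that)
      qed
      have Ep: "E p = of_nat k * p"
      proof -
        have "E (\<Prod>i\<in>B. y i ^ e i) = of_nat k * (\<Prod>i\<in>B. y i ^ e i)"
          unfolding e[symmetric] by (rule derivation_eigen_prod[OF E]) (rule Ey)
        moreover have "E (b * c (Suc k)) = 0" by (rule Econst) (rule v)
        ultimately show ?thesis
          using derivation_mult[OF E, of "\<Prod>i\<in>B. y i ^ e i" "b * c (Suc k)"]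
          by (simp add: p_def mult.assoc)
      qed
      have "((of_nat d * s + of_nat (card B + k)) * p, 0) \<in> fsmod D s f"
      proof (rule fsmod_euler[OF D _ f])
        fix i assume i: "i \<in> B"
        show "v i (y i) = 1" using dual i by simp
        have "(\<Sum>j\<in>B. (e(i := Suc (e i))) j) = Suc k"
          using e B i by (simp add: sum.remove[of B i])
        moreover have "(\<Prod>j\<in>B. y j ^ (e(i := Suc (e i))) j) = y i * (\<Prod>j\<in>B. y j ^ e j)"
          using B i by (simp add: prod.remove[of B i])
        ultimately show "(y i * p, 0) \<in> fsmod D s f"
          using step.IH by (metis p_def mult.assoc)
      qed (use Ep in \<open>simp_all add: E_def\<close>)
      moreover have "{k..<T} = insert k {Suc k..<T}" using step.hyps by auto
      then have "c k = (of_nat d * s + of_nat (card B + k)) * c (Suc k)" by (simp add: c_def)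
      ultimately show "((\<Prod>i\<in>B. y i ^ e i) * (b * c k), 0) \<in> fsmod D s f"
        by (simp add: p_def mult_ac)
    qed
  qed
  from this[of 0, OF le0, rule_format, of "\<lambda>_. 0"]
  have "(b * c 0, 0) \<in> fsmod D s f" by simp
  then show ?thesis by (auto simp: c_def atLeast0LessThan)
qed

section \<open>A radical membership\<close>

definition closed_ideal :: "'r::comm_ring_1 set \<Rightarrow> bool" where
  "closed_ideal J \<longleftrightarrow> 0 \<in> J \<and> (\<forall>x\<in>J. \<forall>y\<in>J. x + y \<in> J) \<and> (\<forall>c. \<forall>x\<in>J. c * x \<in> J)"

lemma closed_ideal_add: "closed_ideal J \<Longrightarrow> x \<in> J \<Longrightarrow> y \<in> J \<Longrightarrow> x + y \<in> J"
  and closed_ideal_scale: "closed_ideal J \<Longrightarrow> x \<in> J \<Longrightarrow> c * x \<in> J"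
  and closed_ideal_0: "closed_ideal J \<Longrightarrow> 0 \<in> J"
  by (auto simp: closed_ideal_def)

lemma closed_ideal_sum: "closed_ideal J \<Longrightarrow> (\<And>i. i \<in> I \<Longrightarrow> g i \<in> J) \<Longrightarrow> (\<Sum>i\<in>I. g i) \<in> J"
  by (induction I rule: infinite_finite_induct) (simp_all add: closed_ideal_def)

lemma closed_ideal_insert:
  assumes J: "closed_ideal J"
  shows "closed_ideal {j + a * r |j r. j \<in> J}"
  unfolding closed_ideal_def
proof (intro conjI allI ballI)
  show "0 \<in> {j + a * r |j r. j \<in> J}"
    using closed_ideal_0[OF J] by (auto intro!: exI[of _ 0])
  show "c * x \<in> {j + a * r |j r. j \<in> J}" if "x \<in> {j + a * r |j r. j \<in> J}" for c x
  proof -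
    from that obtain j r where "x = j + a * r" "j \<in> J" by blast
    then have "c * x = c * j + a * (c * r)" by (simp add: algebra_simps)
    moreover have "c * j \<in> J" by (rule closed_ideal_scale[OF J]) fact
    ultimately show ?thesis by blast
  qed
  show "x + y \<in> {j + a * r |j r. j \<in> J}"
    if "x \<in> {j + a * r |j r. j \<in> J}" "y \<in> {j + a * r |j r. j \<in> J}" for x y
  proof -
    from that obtain j r j' r' where "x = j + a * r" "j \<in> J" "y = j' + a * r'" "j' \<in> J" by blast
    then have "x + y = (j + j') + a * (r + r')" "j + j' \<in> J"
      using closed_ideal_add[OF J] by (simp_all add: algebra_simps)
    then show ?thesis by blast
  qed
qed

text \<open>Modulo J, z^M = a*r, hence z^(M*N+N) = r^N * (z*a)^N = 0. So nilpotence of z modulo J +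
  (a) and of z*a modulo J give nilpotence of z modulo J.\<close>

lemma closed_ideal_power_trick:
  assumes J: "closed_ideal J" and 1: "z ^ M = j + a * r" "j \<in> J" and 2: "(z * a) ^ N \<in> J"
  shows "\<exists>K. z ^ K \<in> J"
proof -
  have "\<exists>j'\<in>J. (j + a * r) ^ N = j' + a ^ N * r ^ N" for N
  proof (induction N)
    case 0
    then show ?case using closed_ideal_0[OF J] by auto
  next
    case (Suc N)
    then obtain j' where j': "j' \<in> J" "(j + a * r) ^ N = j' + a ^ N * r ^ N" by blast
    have "(j + a * r) ^ Suc N = ((j + a * r) * j' + (a ^ N * r ^ N) * j) + a ^ Suc N * r ^ Suc N"
      by (simp add: j' algebra_simps)
    moreover have "(j + a * r) * j' + (a ^ N * r ^ N) * j \<in> J"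
      by (intro closed_ideal_add[OF J] closed_ideal_scale[OF J] j' 1)
    ultimately show ?case by blast
  qed
  then obtain j' where j': "j' \<in> J" "z ^ (M * N) = j' + a ^ N * r ^ N"
    using 1 by (metis power_mult)
  then have "z ^ (M * N + N) = z ^ N * j' + r ^ N * (z * a) ^ N"
    by (simp add: power_add algebra_simps power_mult_distrib)
  then show ?thesis
    by (metis closed_ideal_add[OF J] closed_ideal_scale[OF J] j'(1) 2)
qed

text \<open>This replaces the prime ideal argument: a prime containing J contains either all a i, or
  only those in some A with x not in the ideal generated by a ` A; in the latter case it would
  contain a product of elements outside of it.\<close>

lemma radical_membership:
  assumes "finite C" "closed_ideal J" "a ` A \<subseteq> J" "finite B" "B \<inter> C = {}"
    and "\<And>A'. A \<subseteq> A' \<Longrightarrow> A' \<subseteq> A \<union> C \<Longrightarrow>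
      (\<forall>K. closed_ideal K \<longrightarrow> a ` A' \<subseteq> K \<longrightarrow> x \<in> K) \<or>
      (\<exists>M. (\<Prod>i\<in>B \<union> ((A \<union> C) - A'). a i) ^ M \<in> J)"
    and "A \<inter> C = {}"
  shows "\<exists>M. (x * (\<Prod>i\<in>B. a i)) ^ M \<in> J"
  using assms
proof (induction C arbitrary: A B J rule: finite_induct)
  case empty
  from empty.prems(5)[of A, OF order_refl] show ?case
  proof (simp, elim disjE exE)
    assume "\<forall>K. closed_ideal K \<longrightarrow> a ` A \<subseteq> K \<longrightarrow> x \<in> K"
    then have "x \<in> J" using empty.prems by blast
    then have "(x * (\<Prod>i\<in>B. a i)) ^ 1 \<in> J"
      using closed_ideal_scale[OF empty.prems(1), of x "\<Prod>i\<in>B. a i"] by (simp add: mult.commute)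
    then show ?thesis by blast
  next
    fix M assume "(\<Prod>i\<in>B. a i) ^ M \<in> J"
    then have "(x * (\<Prod>i\<in>B. a i)) ^ M \<in> J"
      using closed_ideal_scale[OF empty.prems(1)] by (simp add: power_mult_distrib)
    then show ?thesis by blast
  qed
next
  case (insert c C)
  define z where "z = x * (\<Prod>i\<in>B. a i)"
  define J' where "J' = {j + a c * r |j r. j \<in> J}"
  have J': "closed_ideal J'" unfolding J'_def by (rule closed_ideal_insert) fact
  have JJ': "J \<subseteq> J'"
  proof
    fix j assume "j \<in> J"
    moreover have "j = j + a c * 0" by simp
    ultimately show "j \<in> J'" unfolding J'_def by blast
  qed
  have "a c = 0 + a c * 1" by simp
  then have "a c \<in> J'"
    unfolding J'_def using closed_ideal_0[OF insert.prems(1)] by blast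
  \<comment> \<open>First alternative for c: it joins the vanishing elements \<open>A\<close>, at
    the price of enlarging J by \<open>a c\<close>.\<close>
  have "\<exists>M. z ^ M \<in> J'"
    unfolding z_def
  proof (rule insert.IH[OF J', where A = "insert c A"])
    show "a ` insert c A \<subseteq> J'" using insert.prems(2) JJ' \<open>a c \<in> J'\<close> by blast
    show "B \<inter> C = {}" "insert c A \<inter> C = {}" "finite B" using insert.prems insert.hyps by auto
    fix A' assume "insert c A \<subseteq> A'" "A' \<subseteq> insert c A \<union> C"
    with insert.prems(5)[of A'] JJ'
    show "(\<forall>K. closed_ideal K \<longrightarrow> a ` A' \<subseteq> K \<longrightarrow> x \<in> K) \<or>
        (\<exists>M. (\<Prod>i\<in>B \<union> (insert c A \<union> C - A'). a i) ^ M \<in> J')" by auto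
  qed
  then obtain M j r where 1: "z ^ M = j + a c * r" "j \<in> J" unfolding J'_def by blast
  \<comment> \<open>Second alternative: c joins the elements \<open>B\<close> that count as
    invertible; J stays, but \<open>a c\<close> appears as an extra factor.\<close>
  have "\<exists>N. (x * (\<Prod>i\<in>insert c B. a i)) ^ N \<in> J"
  proof (rule insert.IH[OF insert.prems(1,2)])
    show "insert c B \<inter> C = {}" "A \<inter> C = {}" "finite (insert c B)"
      using insert.prems insert.hyps by auto
    fix A' assume A': "A \<subseteq> A'" "A' \<subseteq> A \<union> C"
    then have "c \<notin> A'" using insert.prems(6) insert.hyps by auto
    then have "B \<union> (A \<union> insert c C - A') = insert c B \<union> (A \<union> C - A')" by auto
    with insert.prems(5)[of A'] A'
    show "(\<forall>K. closed_ideal K \<longrightarrow> a ` A' \<subseteq> K \<longrightarrow> x \<in> K) \<or>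
        (\<exists>M. (\<Prod>i\<in>insert c B \<union> (A \<union> C - A'). a i) ^ M \<in> J)" by auto
  qed
  moreover have "c \<notin> B" using insert.prems by auto
  ultimately obtain N where "(z * a c) ^ N \<in> J"
    using insert.prems(3) by (auto simp: z_def mult_ac)
  from closed_ideal_power_trick[OF insert.prems(1) 1 this] show ?case by (simp add: z_def)
qed

section \<open>Partial and directional derivatives of polynomials\<close>

lemma pd_superset:
  assumes "finite A" "Poly_Mapping.keys p \<subseteq> A"
  shows "pd v p = (\<Sum>m\<in>A. Poly_Mapping.single (m - Poly_Mapping.single v 1)
           (of_nat (Poly_Mapping.lookup m v) * Poly_Mapping.lookup p m))"
  unfolding pd_def using assms by (intro sum.mono_neutral_left) (auto simp: in_keys_iff)

lemma pd_add: "pd v (p + q) = pd v p + pd v q"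
proof -
  let ?A = "Poly_Mapping.keys p \<union> Poly_Mapping.keys q"
  have A: "finite ?A" "Poly_Mapping.keys (p + q) \<subseteq> ?A" by (simp, rule keys_add)
  show ?thesis
    unfolding pd_superset[OF A] pd_superset[OF A(1) Un_upper1[of "Poly_Mapping.keys p" "Poly_Mapping.keys q"]]
      pd_superset[OF A(1) Un_upper2[of "Poly_Mapping.keys q" "Poly_Mapping.keys p"]]
    by (simp add: lookup_add algebra_simps single_add sum.distrib)
qed

lemma pd_single: "pd v (Poly_Mapping.single m c)
    = Poly_Mapping.single (m - Poly_Mapping.single v 1) (of_nat (Poly_Mapping.lookup m v) * c)"
  by (subst pd_superset[where A = "{m}"]) auto

lemma mpoly_induct [case_names single add]:
  fixes p :: "'a \<Rightarrow>\<^sub>0 'b::comm_monoid_add"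
  assumes single: "\<And>m c. P (Poly_Mapping.single m c)"
    and add: "\<And>p q. P p \<Longrightarrow> P q \<Longrightarrow> P (p + q)"
  shows "P p"
proof -
  have "p = (\<Sum>m\<in>Poly_Mapping.keys p. Poly_Mapping.single m (Poly_Mapping.lookup p m))"
    by (rule poly_mapping_eqI) (auto simp: lookup_sum lookup_single when_def in_keys_iff)
  moreover have "P (\<Sum>m\<in>A. Poly_Mapping.single m (Poly_Mapping.lookup p m))" for A
    using single[of undefined 0]
    by (induction A rule: infinite_finite_induct) (simp_all add: single add)
  ultimately show ?thesis by metis
qed

lemma pd_0: "pd v 0 = 0"
  by (simp add: pd_def)

text \<open>Subtraction of exponents truncates at 0, so it moves across a sum only if v occurs in m.
  Where v does not occur, the coefficient in \<open>pd\<close> is 0 and the exponent is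
  immaterial.\<close>

lemma single_minus_add:
  fixes m n :: "'v \<Rightarrow>\<^sub>0 nat"
  assumes "Poly_Mapping.lookup m v \<noteq> 0"
  shows "(m - Poly_Mapping.single v 1) + n = (m + n) - Poly_Mapping.single v 1"
  using assms by (intro poly_mapping_eqI) (auto simp: lookup_add lookup_minus lookup_single when_def)

lemma pd_mult: "pd v (p * q) = pd v p * q + p * pd v q"
proof (induction p rule: mpoly_induct)
  case (single m c)
  show ?case
  proof (induction q rule: mpoly_induct)
    case (single n d)
    have 1: "Poly_Mapping.single (m + n - Poly_Mapping.single v 1) (of_nat (Poly_Mapping.lookup m v) * (c * d))
      = Poly_Mapping.single (m - Poly_Mapping.single v 1 + n) (of_nat (Poly_Mapping.lookup m v) * c * d)"
      using single_minus_add[of m v n] by (cases "Poly_Mapping.lookup m v = 0") (auto simp: mult.assoc)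
    have 2: "Poly_Mapping.single (m + n - Poly_Mapping.single v 1) (of_nat (Poly_Mapping.lookup n v) * (c * d))
      = Poly_Mapping.single (m + (n - Poly_Mapping.single v 1)) (c * (of_nat (Poly_Mapping.lookup n v) * d))"
      using single_minus_add[of n v m]
      by (cases "Poly_Mapping.lookup n v = 0") (auto simp: mult_ac add.commute)
    show ?case
      by (simp add: mult_single pd_single lookup_add ring_distribs single_add 1 2 del: One_nat_def)
  next
    case (add q r)
    then show ?case by (simp add: pd_add ring_distribs)
  qed
next
  case (add p r)
  then show ?case by (simp add: pd_add ring_distribs)
qed

lemma derivation_pd: "derivation (pd v)"
  by (simp add: derivation_def pd_add pd_mult)

lemma pd_commute: "pd v (pd w p) = pd w (pd v p)"
proof (induction p rule: mpoly_induct)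
  case (single m c)
  show ?case
  proof (cases "v = w")
    case False
    then have "m - Poly_Mapping.single w 1 - Poly_Mapping.single v 1
        = m - Poly_Mapping.single v 1 - Poly_Mapping.single w (1::nat)"
      by (intro poly_mapping_eqI) (auto simp: lookup_minus)
    then show ?thesis using False
      by (simp add: pd_single lookup_minus lookup_single mult_ac)
  qed simp
qed (simp add: pd_add)

lemma mconst_0: "mconst 0 = 0"
  and mconst_1: "mconst 1 = 1"
  and mconst_add: "mconst (a + b) = mconst a + mconst b"
  and mconst_mult: "mconst (a * b) = mconst a * mconst b"
  by (simp_all add: mconst_def single_add mult_single)

lemma mconst_sum: "mconst (\<Sum>i\<in>I. c i) = (\<Sum>i\<in>I. mconst (c i))"
  by (induction I rule: infinite_finite_induct) (simp_all add: mconst_0 mconst_add)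

lemma mconst_of_nat: "mconst (of_nat n) = of_nat n"
  by (induction n) (simp_all add: mconst_0 mconst_1 mconst_add)

lemma pd_mconst: "pd v (mconst c) = 0"
  by (simp add: mconst_def pd_single)

lemma pd_mvar: "pd v (mvar w) = (if v = w then 1 else 0)"
  by (simp add: mvar_def pd_single lookup_single when_def)

text \<open>Constant vector fields indexed by vectors replace coordinate derivatives, so coordinates
  adapted to a subspace can be used without a linear change of variables.\<close>

definition ddir :: "('n::finite \<Rightarrow> complex) \<Rightarrow> 'n mpoly \<Rightarrow> 'n mpoly" where
  "ddir v p = (\<Sum>j\<in>UNIV. mconst (v j) * pd (Some j) p)"

lemma derivation_ddir: "derivation (ddir v)"
  unfolding ddir_def by (rule derivation_lincomb) (rule derivation_pd)

lemma ddir_add_dir: "ddir (\<lambda>j. u j + v j) p = ddir u p + ddir v p"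
  by (simp add: ddir_def mconst_add algebra_simps sum.distrib)

lemma ddir_commute: "ddir u (ddir v p) = ddir v (ddir u p)"
proof -
  have *: "ddir u (ddir v p) = (\<Sum>i\<in>UNIV. \<Sum>j\<in>UNIV. mconst (u i) * (mconst (v j) * pd (Some i) (pd (Some j) p)))"
    for u v
    by (simp add: ddir_def derivation_sum[OF derivation_pd] pd_mult pd_mconst sum_distrib_left)
  show ?thesis
    unfolding *
    by (subst sum.swap) (simp add: pd_commute[of "Some _" "Some _" p] mult_ac)
qed

lemma ddir_mvar_None: "ddir v (mvar None) = 0"
  by (simp add: ddir_def pd_mvar)

lemma ddir_mconst: "ddir v (mconst c) = 0"
  by (simp add: ddir_def pd_mconst)

lemma ddir_linform: "ddir v (linform a) = mconst (\<Sum>j\<in>UNIV. a j * v j)"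
proof -
  have "pd (Some i) (linform a) = mconst (a i)" for i
    by (simp add: linform_def derivation_sum[OF derivation_pd] pd_mult pd_mconst pd_mvar if_distrib
        cong: if_cong)
  then show ?thesis by (simp add: ddir_def mconst_sum mconst_mult mult.commute)
qed

lemma linform_lincomb: "linform (\<lambda>j. \<Sum>i\<in>I. c i * a i j) = (\<Sum>i\<in>I. mconst (c i) * linform (a i))"
  unfolding linform_def mconst_sum mconst_mult sum_distrib_right sum_distrib_left mult.assoc
  by (rule sum.swap)

section \<open>Polynomials in s as elements of C[x,s]\<close>

lemma mpoly_of_spoly_bound:
  assumes "degree b \<le> n"
  shows "mpoly_of_spoly b = (\<Sum>j\<le>n. mconst (coeff b j) * mvar None ^ j)"
proof -
  have pow: "mvar v ^ j = Poly_Mapping.single (Poly_Mapping.single v j) (1::complex)" for v :: "'v" and j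
    by (induction j) (simp_all add: mvar_def mult_single flip: single_add)
  have "mpoly_of_spoly b = (\<Sum>j\<le>degree b. mconst (coeff b j) * mvar None ^ j)"
    unfolding mpoly_of_spoly_def pow mconst_def mult_single by simp
  also have "\<dots> = (\<Sum>j\<le>n. mconst (coeff b j) * mvar None ^ j)"
    using assms by (intro sum.mono_neutral_left) (auto simp: coeff_eq_0 mconst_0)
  finally show ?thesis .
qed

lemma mpoly_of_spoly_add: "mpoly_of_spoly (b + c) = mpoly_of_spoly b + mpoly_of_spoly c"
proof -
  let ?n = "max (degree b) (degree c)"
  have "degree (b + c) \<le> ?n" by (rule degree_add_le_max)
  then show ?thesis
    by (simp add: mpoly_of_spoly_bound[where n = ?n] mconst_add algebra_simps sum.distrib)
qed

lemma mpoly_of_spoly_smult: "mpoly_of_spoly (smult a b) = mconst a * mpoly_of_spoly b"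
  by (simp add: mpoly_of_spoly_bound[where n = "degree b"] degree_smult_le sum_distrib_left
      mconst_mult mult.assoc)

lemma mpoly_of_spoly_pCons: "mpoly_of_spoly (pCons a b) = mconst a + mvar None * mpoly_of_spoly b"
  by (simp add: mpoly_of_spoly_bound[where n = "Suc (degree b)" and b = "pCons a b"]
      mpoly_of_spoly_bound[where n = "degree b" and b = b] degree_pCons_le sum.atMost_Suc_shift
      sum_distrib_left mult_ac del: sum.atMost_Suc)

lemma mpoly_of_spoly_0: "mpoly_of_spoly 0 = 0"
  by (simp add: mpoly_of_spoly_def)

lemma mpoly_of_spoly_1: "mpoly_of_spoly 1 = 1"
  by (simp add: mpoly_of_spoly_def)

lemma mpoly_of_spoly_mult: "mpoly_of_spoly (b * c) = mpoly_of_spoly b * mpoly_of_spoly c"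
  by (induction b)
    (simp_all add: mpoly_of_spoly_0 mpoly_of_spoly_add mpoly_of_spoly_smult mpoly_of_spoly_pCons
      mconst_0 algebra_simps)

lemma mpoly_of_spoly_linear: "mpoly_of_spoly [:of_nat a, of_nat d:] = of_nat d * mvar None + of_nat a"
  by (simp add: mpoly_of_spoly_pCons mpoly_of_spoly_0 mconst_of_nat algebra_simps)

lemma mpoly_of_spoly_prod: "mpoly_of_spoly (\<Prod>i\<in>I. b i) = (\<Prod>i\<in>I. mpoly_of_spoly (b i))"
  by (induction I rule: infinite_finite_induct) (simp_all add: mpoly_of_spoly_1 mpoly_of_spoly_mult)

lemma ddir_mpoly_of_spoly: "ddir v (mpoly_of_spoly b) = 0"
  by (induction b)
    (simp_all add: mpoly_of_spoly_0 mpoly_of_spoly_pCons derivation_0[OF derivation_ddir]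
      derivation_add[OF derivation_ddir] derivation_mult[OF derivation_ddir] ddir_mconst ddir_mvar_None)

section \<open>Bernstein-Sato polynomials\<close>

abbreviation op_sum :: "'n mpoly \<Rightarrow> nat \<Rightarrow> ('n mpoly \<times> 'n list) list \<Rightarrow> 'n mpoly" where
  "op_sum f K P \<equiv> (\<Sum>(h, k)\<leftarrow>apply_op f P. h * f ^ (K - k))"

text \<open>The pairs for which g * f^(s-k) lies in D_X[s] f^(s+1). Denominators are cleared as in
  \<open>bs_equation\<close>, so being a b-function is membership at level 0.\<close>

definition dmod :: "'n mpoly \<Rightarrow> ('n mpoly \<times> nat) set" where
  "dmod f = {(g, k). \<exists>P K. k \<le> K \<and> (\<forall>(h, j)\<in>set (apply_op f P). j \<le> K) \<and>
     op_sum f K P = g * f ^ (K - k)}"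

lemma is_b_function_iff: "is_b_function f b \<longleftrightarrow> (mpoly_of_spoly b, 0) \<in> dmod f"
  by (simp add: is_b_function_def bs_equation_def dmod_def)

text \<open>Multiplying by a power of f moves the cleared equation to any higher level; two
  operators can be added only over a common denominator.\<close>

lemma dmod_level:
  assumes "(g, k) \<in> dmod f"
  shows "\<exists>P K0. \<forall>K\<ge>K0. k \<le> K \<and> (\<forall>(h, j)\<in>set (apply_op f P). j \<le> K) \<and> op_sum f K P = g * f ^ (K - k)"
proof -
  from assms obtain P K0 where P: "k \<le> K0" "\<forall>(h, j)\<in>set (apply_op f P). j \<le> K0"
    "op_sum f K0 P = g * f ^ (K0 - k)" by (auto simp: dmod_def)
  have "op_sum f K P = g * f ^ (K - k)" if K: "K \<ge> K0" for K
  proof -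
    have "op_sum f K P = (\<Sum>(h, j)\<leftarrow>apply_op f P. f ^ (K - K0) * (h * f ^ (K0 - j)))"
    proof (intro arg_cong[where f = sum_list] map_cong refl, clarify)
      fix h j assume "(h, j) \<in> set (apply_op f P)"
      then have "j \<le> K0" using P(2) by blast
      then have "f ^ (K - j) = f ^ (K - K0) * f ^ (K0 - j)" using K by (simp flip: power_add)
      then show "h * f ^ (K - j) = f ^ (K - K0) * (h * f ^ (K0 - j))" by (simp add: mult_ac)
    qed
    also have "\<dots> = f ^ (K - K0) * op_sum f K0 P"
      by (simp add: sum_list_const_mult case_prod_unfold)
    also have "\<dots> = g * (f ^ (K - K0) * f ^ (K0 - k))" by (simp only: P(3) mult_ac)
    also have "f ^ (K - K0) * f ^ (K0 - k) = f ^ (K - k)" using K P(1) by (simp flip: power_add)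
    finally show ?thesis .
  qed
  then show ?thesis using P by (intro exI[of _ P] exI[of _ K0]) fastforce
qed

lemma dmod_add:
  assumes "(g, k) \<in> dmod f" "(h, k) \<in> dmod f"
  shows "(g + h, k) \<in> dmod f"
proof -
  obtain P K0 where P: "\<And>K. K\<ge>K0 \<Longrightarrow> k \<le> K \<and> (\<forall>(h, j)\<in>set (apply_op f P). j \<le> K) \<and> op_sum f K P = g * f ^ (K - k)"
    using dmod_level[OF assms(1)] by blast
  obtain Q K1 where Q: "\<And>K. K\<ge>K1 \<Longrightarrow> k \<le> K \<and> (\<forall>(h, j)\<in>set (apply_op f Q). j \<le> K) \<and> op_sum f K Q = h * f ^ (K - k)"
    using dmod_level[OF assms(2)] by blast
  let ?K = "max K0 K1"
  have "apply_op f (P @ Q) = apply_op f P @ apply_op f Q" by (simp add: apply_op_def)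
  then show ?thesis using P[of ?K] Q[of ?K] unfolding dmod_def
    by (auto intro!: exI[of _ "P @ Q"] exI[of _ ?K] simp: algebra_simps)
qed

lemma dmod_scale:
  assumes "(g, k) \<in> dmod f"
  shows "(c * g, k) \<in> dmod f"
proof -
  obtain P K where P: "k \<le> K" "\<forall>(h, j)\<in>set (apply_op f P). j \<le> K" "op_sum f K P = g * f ^ (K - k)"
    using assms by (auto simp: dmod_def)
  let ?P = "map (\<lambda>(a, ws). (c * a, ws)) P"
  have eq: "apply_op f ?P = map (\<lambda>(h, j). (c * h, j)) (apply_op f P)"
    by (simp add: apply_op_def case_prod_unfold mult.assoc)
  have "op_sum f K ?P = c * op_sum f K P"
    unfolding eq by (simp add: case_prod_unfold sum_list_const_mult[symmetric] mult.assoc comp_def)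
  moreover have "\<forall>(h, j)\<in>set (apply_op f ?P). j \<le> K"
    unfolding eq using P(2) by auto
  ultimately show ?thesis using P unfolding dmod_def by (auto simp: mult.assoc)
qed

lemma dmod_0: "(0, k) \<in> dmod f"
  unfolding dmod_def by (auto intro!: exI[of _ "[]"] simp: apply_op_def)

lemma dmod_sum: "(\<And>i. i \<in> I \<Longrightarrow> (g i, k) \<in> dmod f) \<Longrightarrow> ((\<Sum>i\<in>I. g i), k) \<in> dmod f"
  by (induction I rule: infinite_finite_induct) (simp_all add: dmod_0 dmod_add)

lemma dmod_gen: "(f, 0) \<in> dmod f"
  unfolding dmod_def by (auto intro!: exI[of _ "[(1, [])]"] exI[of _ 0] simp: apply_op_def dword_def)

lemma dmod_raise:
  assumes "(g, k) \<in> dmod f"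
  shows "(g * f, Suc k) \<in> dmod f"
proof -
  obtain P K0 where P: "\<And>K. K\<ge>K0 \<Longrightarrow> k \<le> K \<and> (\<forall>(h, j)\<in>set (apply_op f P). j \<le> K) \<and> op_sum f K P = g * f ^ (K - k)"
    using dmod_level[OF assms(1)] by blast
  let ?K = "max K0 (Suc k)"
  have "?K - k = Suc (?K - Suc k)" by simp
  then have "f ^ (?K - k) = f * f ^ (?K - Suc k)" by (simp only: power_Suc)
  then show ?thesis using P[of ?K] unfolding dmod_def
    by (auto intro!: exI[of _ P] exI[of _ ?K] simp: mult_ac)
qed

lemma dmod_lower:
  assumes "(g * f, Suc k) \<in> dmod f"
  shows "(g, k) \<in> dmod f"
proof -
  obtain P K where P: "Suc k \<le> K" "\<forall>(h, j)\<in>set (apply_op f P). j \<le> K" "op_sum f K P = g * f * f ^ (K - Suc k)"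
    using assms by (auto simp: dmod_def)
  have "K - k = Suc (K - Suc k)" using P(1) by simp
  then have "f ^ (K - k) = f * f ^ (K - Suc k)" by (simp only: power_Suc)
  then show ?thesis using P unfolding dmod_def
    by (auto intro!: exI[of _ P] exI[of _ K] simp: mult_ac)
qed

text \<open>Well-definedness of differentiation: (g, k) and (g * f^m, k + m) represent the same
  element, and the numerators of their derivatives differ by the same factor f^m.\<close>

lemma dstep_power:
  fixes f g :: "'n mpoly" and i :: 'n
  defines "d \<equiv> pd (Some i)"
  shows "f * d (g * f ^ m) + (mvar None - of_nat (k + m)) * (g * f ^ m) * d f
    = (f * d g + (mvar None - of_nat k) * g * d f) * f ^ m"
proof -
  have "f * d (f ^ m) = of_nat m * f ^ m * d f"
  proof (cases m)
    case (Suc n)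
    then show ?thesis
      unfolding d_def Suc derivation_power[OF derivation_pd] by (simp add: algebra_simps)
  qed (simp add: d_def derivation_1[OF derivation_pd])
  moreover have "f * d (g * f ^ m) = f * d g * f ^ m + g * (f * d (f ^ m))"
    by (simp add: d_def pd_mult algebra_simps)
  ultimately show ?thesis by (simp add: algebra_simps)
qed

lemma dmod_dstep:
  fixes f g :: "'n mpoly" and i :: 'n
  assumes "(g, k) \<in> dmod f"
  shows "(f * pd (Some i) g + (mvar None - of_nat k) * g * pd (Some i) f, Suc k) \<in> dmod f"
proof -
  obtain P K where P: "k \<le> K" "\<forall>(h, j)\<in>set (apply_op f P). j \<le> K" "op_sum f K P = g * f ^ (K - k)"
    using assms by (auto simp: dmod_def)
  define d where "d = pd (Some i :: 'n option)"
  \<comment> \<open>The numerator of the derivative of p * f^(s-K); working at one fixed level makes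
    it additive.\<close>
  define D where "D p = f * d p + (mvar None - of_nat K) * p * d f" for p
  \<comment> \<open>Left multiplication by d_i in the ring of operators: d_i * (a * w) = (d_i a) * w
    + a * (d_i * w) for every term.\<close>
  let ?P = "\<lambda>P. concat (map (\<lambda>(a, ws). [(d a, ws), (a, i # ws)]) P)"
  have D_add: "D (p + q) = D p + D q" for p q
    by (simp add: D_def d_def pd_add algebra_simps)
  have D_pow: "D (h * f ^ (K - j)) = (f * d h + (mvar None - of_nat j) * h * d f) * f ^ (K - j)"
    if "j \<le> K" for h j
    using dstep_power[of f i h "K - j" j] that by (simp add: D_def d_def)
  have "op_sum f (Suc K) (?P P) = D (op_sum f K P) \<and> (\<forall>(h, j)\<in>set (apply_op f (?P P)). j \<le> Suc K)"
    using P(2)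
  proof (induction P)
    case Nil
    then show ?case by (simp add: apply_op_def D_def d_def pd_0)
  next
    case (Cons t P)
    obtain a ws where t: "t = (a, ws)" by fastforce
    obtain h j where hj: "dword f ws (f, 0) = (h, j)" by fastforce
    have j: "j \<le> K" using Cons.prems by (auto simp: apply_op_def t hj)
    have step: "dword f (i # ws) (f, 0) = (f * d h + (mvar None - of_nat j) * h * d f, Suc j)"
      using hj by (simp add: dword_def dstep_def d_def)
    have IH: "op_sum f (Suc K) (?P P) = D (op_sum f K P)" "\<forall>(h, j)\<in>set (apply_op f (?P P)). j \<le> Suc K"
      using Cons by (auto simp: apply_op_def)
    have app: "apply_op f (t # P) = (a * h, j) # apply_op f P"
      "apply_op f (?P (t # P)) = (d a * h, j) #
        (a * (f * d h + (mvar None - of_nat j) * h * d f), Suc j) # apply_op f (?P P)"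
      using step by (simp_all add: apply_op_def t hj)
    have "f ^ (Suc K - j) = f * f ^ (K - j)" using j by (simp add: Suc_diff_le)
    then show ?case
      unfolding app using IH j D_pow[OF j, of "a * h"]
      by (simp add: D_add d_def pd_mult algebra_simps)
  qed
  moreover have "D (op_sum f K P) = (f * d g + (mvar None - of_nat k) * g * d f) * f ^ (Suc K - Suc k)"
    unfolding P(3) using D_pow[OF P(1)] by simp
  ultimately show ?thesis
    using P(1) unfolding dmod_def d_def[symmetric] by (auto intro!: exI[of _ "?P P"] exI[of _ "Suc K"])
qed

text \<open>Turns the inductive module into actual operators: each generation rule is a closure
  property of \<open>dmod\<close>, a directional derivative being a linear combination of coordinate
  ones.\<close>

lemma fsmod_ddir_subset_dmod: "fsmod (range ddir) (mvar None) f \<subseteq> dmod f"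
proof clarify
  fix g k assume "(g, k) \<in> fsmod (range ddir) (mvar None) f"
  then show "(g, k) \<in> dmod f"
  proof (induction rule: fsmod.induct)
    case (diff d g k)
    then obtain v where v: "d = ddir v" by blast
    have "((\<Sum>j\<in>UNIV. mconst (v j) * (f * pd (Some j) g + (mvar None - of_nat k) * g * pd (Some j) f)), Suc k)
        \<in> dmod f"
      by (intro dmod_sum dmod_scale dmod_dstep diff.IH)
    then show ?case
      by (simp add: v ddir_def sum_distrib_left sum.distrib sum_subtractf algebra_simps)
  qed (auto intro: dmod_gen dmod_scale dmod_add dmod_raise dmod_lower)
qed

section \<open>The ideal of b-functions in C[s]\<close>

lemma is_b_function_add: "is_b_function f b \<Longrightarrow> is_b_function f c \<Longrightarrow> is_b_function f (b + c)"
  by (simp add: is_b_function_iff mpoly_of_spoly_add dmod_add)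

lemma is_b_function_mult: "is_b_function f b \<Longrightarrow> is_b_function f (a * b)"
  by (simp add: is_b_function_iff mpoly_of_spoly_mult dmod_scale)

lemma is_b_function_diff: "is_b_function f b \<Longrightarrow> is_b_function f c \<Longrightarrow> is_b_function f (b - c)"
  using is_b_function_add[of f b "[:-1:] * c"] is_b_function_mult[of f c "[:-1:]"] by simp

text \<open>The b-functions form an ideal of C[s], and the monic element of least degree generates
  it by division with remainder. A nonzero b-function is what makes the definite description
  meaningful.\<close>

lemma bernstein_sato_dvd:
  assumes "b \<noteq> 0" "is_b_function f b"
  shows "bernstein_sato f \<noteq> 0" "bernstein_sato f dvd b"
proof -
  let ?P = "\<lambda>b. lead_coeff b = 1 \<and> is_b_function f b \<and>
      (\<forall>b'. b' \<noteq> 0 \<and> is_b_function f b' \<longrightarrow> degree b \<le> degree b')"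
  obtain c where c: "c \<noteq> 0" "is_b_function f c"
    and min: "\<And>b'. b' \<noteq> 0 \<Longrightarrow> is_b_function f b' \<Longrightarrow> degree c \<le> degree b'"
    using ex_has_least_nat[of "\<lambda>b. b \<noteq> 0 \<and> is_b_function f b" b degree] assms by blast
  let ?c = "smult (inverse (lead_coeff c)) c"
  have "is_b_function f ?c" using is_b_function_mult[OF c(2), of "[:inverse (lead_coeff c):]"] by simp
  then have Pc: "?P ?c" using c min by simp
  \<comment> \<open>The difference of two distinct monic b-functions of minimal degree would be a
    b-function of smaller degree.\<close>
  have uniq: "b1 = b2" if "?P b1" "?P b2" for b1 b2
  proof (rule ccontr)
    assume "b1 \<noteq> b2"
    have deg: "degree b1 = degree b2" using that by (metis le_antisym leading_coeff_0_iff one_neq_zero)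
    have "degree b1 \<le> degree (b1 - b2)"
      using that \<open>b1 \<noteq> b2\<close> is_b_function_diff[of f b1 b2] by simp
    moreover have "degree (b1 - b2) \<le> degree b1" using deg degree_diff_le_max[of b1 b2] by simp
    ultimately have "coeff (b1 - b2) (degree b1) \<noteq> 0"
      using \<open>b1 \<noteq> b2\<close> by (metis le_antisym leading_coeff_0_iff right_minus_eq)
    then show False using that deg by simp
  qed
  have B: "?P (bernstein_sato f)"
    unfolding bernstein_sato_def by (rule theI[where P = ?P, OF Pc]) (metis uniq Pc)
  then show 0: "bernstein_sato f \<noteq> 0" by auto
  have "is_b_function f (b mod bernstein_sato f)"
    using is_b_function_diff[OF assms(2) is_b_function_mult[of f "bernstein_sato f" "b div bernstein_sato f"]] B
    by (simp add: minus_div_mult_eq_mod)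
  then have "b mod bernstein_sato f = 0"
    using B degree_mod_less[OF 0, of b] by (metis leD)
  then show "bernstein_sato f dvd b" by auto
qed

section \<open>Linear forms\<close>

text \<open>Supplies complex scalars on functions, so that span and independence of coefficient
  vectors are available; addition is pointwise.\<close>

definition cscale :: "complex \<Rightarrow> ('n \<Rightarrow> complex) \<Rightarrow> 'n \<Rightarrow> complex" where
  "cscale c v = (\<lambda>j. c * v j)"

interpretation cfun: vector_space cscale
  by unfold_locales (auto simp: cscale_def plus_fun_def algebra_simps)

definition dot :: "('n::finite \<Rightarrow> complex) \<Rightarrow> ('n \<Rightarrow> complex) \<Rightarrow> complex" where
  "dot a v = (\<Sum>j\<in>UNIV. a j * v j)"

lemma mem_hyp_iff: "x \<in> hyp a \<longleftrightarrow> dot a x = 0"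
  by (simp add: hyp_def dot_def)

lemma ddir_linform_dot: "ddir v (linform a) = mconst (dot a v)"
  by (simp add: ddir_linform dot_def)

lemma fun_sum_apply: "(\<Sum>i\<in>I. g i) j = (\<Sum>i\<in>I. (g i j :: complex))"
  by (induction I rule: infinite_finite_induct) auto

lemma dot_add: "dot (a + b) v = dot a v + dot b v"
  by (simp add: dot_def distrib_right sum.distrib)

lemma dot_cscale: "dot (cscale c a) v = c * dot a v"
  unfolding dot_def cscale_def sum_distrib_left mult.assoc ..

lemma dot_sum: "dot (\<Sum>i\<in>I. cscale (c i) (a i)) v = (\<Sum>i\<in>I. c i * dot (a i) v)"
proof (induction I rule: infinite_finite_induct)
  case (insert i I)
  show ?case unfolding sum.insert[OF insert.hyps(1,2)] dot_add dot_cscale insert.IH ..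
qed (simp_all add: dot_def)

lemma linform_sum: "linform (\<Sum>i\<in>I. cscale (c i) (a i)) = (\<Sum>i\<in>I. mconst (c i) * linform (a i))"
proof -
  have "(\<Sum>i\<in>I. cscale (c i) (a i)) = (\<lambda>j. \<Sum>i\<in>I. c i * a i j)"
    by (rule ext) (simp add: fun_sum_apply cscale_def)
  then show ?thesis by (simp only: linform_lincomb)
qed

text \<open>Prescribed values on an independent set extend to a linear functional, and a functional
  on coefficient vectors is \<open>dot\<close> with the vector of its values on the unit
  vectors.\<close>

lemma independent_dual:
  fixes B :: "('n::finite \<Rightarrow> complex) set"
  assumes "cfun.independent B"
  shows "\<exists>v. \<forall>b\<in>B. dot b v = f b"
proof -
  interpret functional: vector_space_pair cscale "(*) :: complex \<Rightarrow> complex \<Rightarrow> complex"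
    by unfold_locales (auto simp: algebra_simps)
  from functional.linear_independent_extend[OF assms, of f]
  obtain g where "Vector_Spaces.linear cscale (*) g \<and> (\<forall>x\<in>B. g x = f x)" ..
  then have g: "Vector_Spaces.linear cscale (*) g" "\<forall>x\<in>B. g x = f x" by simp_all
  define e where "e i = (\<lambda>j. if i = j then 1 else 0 :: complex)" for i :: 'n
  interpret g: Vector_Spaces.linear cscale "(*)" g by (rule g(1))
  have "dot a (\<lambda>j. g (e j)) = g a" for a
  proof -
    have "a = (\<Sum>i\<in>UNIV. cscale (a i) (e i))"
      by (rule ext) (simp add: fun_sum_apply cscale_def e_def if_distrib[where f = "(*) _"] cong: if_cong)
    then have "g a = g (\<Sum>i\<in>UNIV. cscale (a i) (e i))" by (rule arg_cong)
    also have "\<dots> = (\<Sum>i\<in>UNIV. a i * g (e i))" by (simp add: g.sum g.scale)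
    finally show ?thesis by (simp add: dot_def)
  qed
  then show ?thesis using g(2) by (intro exI[of _ "\<lambda>j. g (e j)"]) simp
qed

text \<open>Adjoin a to a basis of the span of A and prescribe 1 at a, 0 on the basis. The resulting
  v lies on all hyperplanes of A but not on that of a.\<close>

lemma separating_vector:
  fixes a :: "'n::finite \<Rightarrow> complex"
  assumes "a \<notin> cfun.span A"
  shows "\<exists>v. (\<forall>b\<in>A. dot b v = 0) \<and> dot a v = 1"
proof -
  obtain B where B: "B \<subseteq> A" "cfun.independent B" "A \<subseteq> cfun.span B"
    using cfun.maximal_independent_subset by blast
  have "a \<notin> cfun.span B" using assms B(1) cfun.span_mono by blast
  then have "a \<notin> B" using cfun.span_base by blast
  have "cfun.independent (insert a B)" by (rule cfun.independent_insertI) fact+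
  from independent_dual[OF this, of "\<lambda>b. if b = a then 1 else 0"]
  obtain v where v: "\<forall>b\<in>insert a B. dot b v = (if b = a then 1 else 0)" ..
  have "dot b v = 0" if "b \<in> cfun.span B" for b
    using that
  proof (induction rule: cfun.span_induct_alt)
    case base
    show ?case by (simp add: dot_def)
  next
    case (step c x y)
    then have "dot x v = 0" using v \<open>a \<notin> B\<close> by auto
    moreover have "dot (cscale c x + y) v = c * dot x v + dot y v"
      by (simp only: dot_add dot_cscale)
    ultimately have "dot (cscale c x + y) v = 0" using step by (simp only: mult_zero_right add_0_left)
    then show ?case by (simp only: plus_fun_def)
  qed
  then show ?thesis using v B(3) by (intro exI[of _ v]) auto
qed

lemma span_imp_lincomb:
  assumes "finite B" "a \<in> cfun.span B"
  obtains c where "a = (\<Sum>b\<in>B. cscale (c b) b)"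
proof -
  have "a \<in> range (\<lambda>u. \<Sum>b\<in>B. cscale (u b) b)"
    using assms(2) unfolding cfun.span_finite[OF assms(1)] .
  then show ?thesis using that by blast
qed

lemma linform_in_ideal:
  assumes "closed_ideal K" "linform ` A \<subseteq> K" "finite A" "a \<in> cfun.span A"
  shows "linform a \<in> K"
proof -
  obtain c where c: "a = (\<Sum>b\<in>A. cscale (c b) b)"
    using span_imp_lincomb[OF assms(3,4)] .
  then have "linform a = (\<Sum>b\<in>A. mconst (c b) * linform b)" by (simp only: linform_sum)
  also have "\<dots> \<in> K"
    using assms(2) by (intro closed_ideal_sum[OF assms(1)] closed_ideal_scale[OF assms(1)]) auto
  finally show ?thesis .
qed

text \<open>The Euler vector field of the space spanned by the forms in A.\<close>

lemma euler_basis: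
  fixes A :: "('n::finite \<Rightarrow> complex) set"
  assumes "finite A"
  obtains B w where "B \<subseteq> A" "finite B"
    "\<forall>b\<in>B. \<forall>b'\<in>B. ddir (w b) (linform b') = (if b = b' then 1 else 0)"
    "\<forall>a\<in>A. (\<Sum>b\<in>B. linform b * ddir (w b) (linform a)) = linform a"
proof -
  obtain B where B: "B \<subseteq> A" "cfun.independent B" "A \<subseteq> cfun.span B"
    using cfun.maximal_independent_subset by blast
  have fin: "finite B" using B assms finite_subset by blast
  have "\<exists>v. \<forall>b'\<in>B. dot b' v = (if b = b' then 1 else 0)" for b
    by (rule independent_dual[OF B(2)])
  then obtain w where w: "\<And>b b'. b' \<in> B \<Longrightarrow> dot b' (w b) = (if b = b' then 1 else 0)" by metis
  have "(\<Sum>b\<in>B. linform b * ddir (w b) (linform a)) = linform a" if "a \<in> A" for a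
  proof -
    from span_imp_lincomb[OF fin subsetD[OF B(3) that]]
    obtain c where c: "a = (\<Sum>b\<in>B. cscale (c b) b)" .
    have "dot a (w b) = c b" if "b \<in> B" for b
      unfolding c dot_sum using that fin by (simp add: w if_distrib cong: if_cong)
    then have "(\<Sum>b\<in>B. linform b * ddir (w b) (linform a)) = (\<Sum>b\<in>B. mconst (c b) * linform b)"
      by (intro sum.cong) (simp_all add: ddir_linform_dot mult.commute)
    then show ?thesis unfolding c linform_sum by simp
  qed
  moreover have "ddir (w b) (linform b') = (if b = b' then 1 else 0)" if "b' \<in> B" for b b'
    using w[OF that] by (simp add: ddir_linform_dot mconst_0 mconst_1)
  ultimately show ?thesis using B(1) fin by (intro that[of B w]) simp_all
qed

section \<open>Orders of roots\<close>

text \<open>Links the b(-s) of the theorem with b itself: substituting -s turns (s+a)^n into (s-a)^n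
  up to sign.\<close>

lemma order_reflect:
  fixes p :: "complex poly"
  assumes "p \<noteq> 0"
  shows "order a (pcompose p [:0, -1:]) = order (- a) p"
proof -
  let ?n = "order (- a) p"
  obtain q where q: "p = [:a, 1:] ^ ?n * q" "poly q (- a) \<noteq> 0"
    using order_decomp[OF assms, of "- a"] by (auto simp: poly_eq_0_iff_dvd)
  have pow: "pcompose ([:a, 1:] ^ n) [:0, -1:] = smult ((- 1) ^ n) ([:- a, 1:] ^ n)" for n
  proof (induction n)
    case (Suc n)
    have "pcompose [:a, 1:] [:0, -1:] = smult (- 1) [:- a, 1:]" by (simp add: pcompose_pCons)
    with Suc show ?case by (simp only: power_Suc pcompose_mult mult_smult_left mult_smult_right smult_smult)
        (simp add: mult.commute)
  qed (simp add: pcompose_1)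
  define r where "r = smult ((- 1) ^ ?n) (pcompose q [:0, -1:])"
  have eq: "pcompose p [:0, -1:] = [:- a, 1:] ^ ?n * r"
    by (subst q(1)) (simp add: pcompose_mult pow r_def)
  have r: "poly r a \<noteq> 0" using q(2) by (simp add: r_def poly_pcompose)
  then have "[:- a, 1:] ^ ?n * r \<noteq> 0" by auto
  then show ?thesis by (simp add: eq order_mult order_power_n_n order_0I[OF r])
qed

lemma order_prod:
  "(\<And>i. i \<in> I \<Longrightarrow> p i \<noteq> 0) \<Longrightarrow> order z (\<Prod>i\<in>I. p i) = (\<Sum>i\<in>I. order z (p i :: complex poly))"
proof (induction I rule: infinite_finite_induct)
  case (insert i I)
  then have "p i * (\<Prod>i\<in>I. p i) \<noteq> 0" by auto
  then show ?case using insert by (simp add: order_mult)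
qed (simp_all add: order_0I)

text \<open>Complex polynomials split, so a least common multiple is the product of linear factors
  raised to their maximal orders. The last property matters most: at each z the order is bounded by
  that of a single member of P.\<close>

lemma common_multiple_max_order:
  fixes P :: "complex poly set"
  assumes "finite P" "P \<noteq> {}" "0 \<notin> P"
  obtains b where "b \<noteq> 0" "\<forall>p\<in>P. p dvd b" "\<forall>z. \<exists>p\<in>P. order z b \<le> order z p"
proof -
  define H where "H z = Max (order z ` P)" for z
  define Z where "Z = (\<Union>p\<in>P. {z. poly p z = 0})"
  define b where "b = (\<Prod>z\<in>Z. [:- z, 1:] ^ H z)"
  have Z: "finite Z" unfolding Z_def using assms by (auto intro!: poly_roots_finite)
  have H: "order z p \<le> H z" if "p \<in> P" for p z
    unfolding H_def using assms that by auto
  have "p dvd b" if "p \<in> P" for p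
  proof -
    have "p \<noteq> 0" using that assms by auto
    have "p = smult (lead_coeff p) (\<Prod>z|poly p z = 0. [:- z, 1:] ^ order z p)"
      by (rule complex_poly_decompose[symmetric])
    also have "\<dots> dvd (\<Prod>z|poly p z = 0. [:- z, 1:] ^ order z p)"
      using \<open>p \<noteq> 0\<close> by (simp add: smult_dvd_iff)
    also have "\<dots> dvd (\<Prod>z|poly p z = 0. [:- z, 1:] ^ H z)"
      by (intro prod_dvd_prod le_imp_power_dvd H that)
    also have "\<dots> dvd b"
      unfolding b_def using that Z by (intro prod_dvd_prod_subset) (auto simp: Z_def)
    finally show ?thesis .
  qed
  moreover have b0: "b \<noteq> 0" by (auto simp: b_def Z)
  moreover have "\<exists>p\<in>P. order z b \<le> order z p" for z
  proof -
    have "order z b = (\<Sum>u\<in>Z. if u = z then H z else 0)"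
      unfolding b_def by (subst order_prod) (auto intro!: sum.cong simp: order_power_n_n order_0I)
    then have "order z b \<le> H z" using Z by simp
    moreover have "H z \<in> order z ` P" unfolding H_def using assms by (intro Max_in) auto
    ultimately show ?thesis by auto
  qed
  ultimately show ?thesis using that by blast
qed

section \<open>Flats and localized equations\<close>

definition form_indices :: "('n::finite \<Rightarrow> complex) list \<Rightarrow> ('n \<Rightarrow> complex) set \<Rightarrow> nat set" where
  "form_indices as L = {i. i < length as \<and> L \<subseteq> hyp (as ! i)}"

text \<open>Unlike edges, flats include the whole space.\<close>

definition flat :: "('n::finite \<Rightarrow> complex) list \<Rightarrow> ('n \<Rightarrow> complex) set \<Rightarrow> bool" where
  "flat as L \<longleftrightarrow> (\<exists>S\<subseteq>{..<length as}. L = (\<Inter>i\<in>S. hyp (as ! i)))"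

definition local_eq :: "('n::finite \<Rightarrow> complex) list \<Rightarrow> ('n \<Rightarrow> complex) set \<Rightarrow> 'n mpoly" where
  "local_eq as L = (\<Prod>i\<in>form_indices as L. linform (as ! i))"

lemma finite_form_indices: "finite (form_indices as L)"
  by (simp add: form_indices_def)

lemma mult_eq_card: "mult as L = card (form_indices as L)"
  by (simp add: mult_def form_indices_def)

lemma form_indices_antimono: "L \<subseteq> L' \<Longrightarrow> form_indices as L' \<subseteq> form_indices as L"
  by (auto simp: form_indices_def)

lemma flatI: "S \<subseteq> {..<length as} \<Longrightarrow> flat as (\<Inter>i\<in>S. hyp (as ! i))"
  by (auto simp: flat_def)

lemma flat_eq:
  assumes "flat as L"
  shows "L = (\<Inter>i\<in>form_indices as L. hyp (as ! i))"
proof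
  show "L \<subseteq> (\<Inter>i\<in>form_indices as L. hyp (as ! i))" by (auto simp: form_indices_def)
  obtain S where S: "S \<subseteq> {..<length as}" "L = (\<Inter>i\<in>S. hyp (as ! i))"
    using assms by (auto simp: flat_def)
  then have "S \<subseteq> form_indices as L" by (auto simp: form_indices_def)
  then show "(\<Inter>i\<in>form_indices as L. hyp (as ! i)) \<subseteq> L" unfolding S(2) by (rule INT_anti_mono) simp
qed

text \<open>A flat is recovered from the forms vanishing on it, so passing to a larger flat must
  lose a form; this is the measure of the induction.\<close>

lemma form_indices_psubset:
  assumes "flat as L" "flat as L'" "L \<subset> L'"
  shows "form_indices as L' \<subset> form_indices as L"
proof
  show "form_indices as L' \<subseteq> form_indices as L" using assms(3) by (intro form_indices_antimono) auto
  show "form_indices as L' \<noteq> form_indices as L"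
    using flat_eq[OF assms(1)] flat_eq[OF assms(2)] assms(3) by auto
qed

lemma finite_flats: "finite {L. flat as L}"
proof (rule finite_subset)
  show "{L. flat as L} \<subseteq> (\<lambda>S. \<Inter>i\<in>S. hyp (as ! i)) ` Pow {..<length as}"
    by (auto simp: flat_def)
qed simp

lemma is_edge_iff: "is_edge as L \<longleftrightarrow> flat as L \<and> form_indices as L \<noteq> {}"
proof
  assume "is_edge as L"
  then obtain S where S: "S \<noteq> {}" "S \<subseteq> {..<length as}" "L = (\<Inter>i\<in>S. hyp (as ! i))"
    by (auto simp: is_edge_def)
  then have "S \<subseteq> form_indices as L" by (auto simp: form_indices_def)
  then show "flat as L \<and> form_indices as L \<noteq> {}" using S flatI by auto
next
  assume L: "flat as L \<and> form_indices as L \<noteq> {}"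
  then show "is_edge as L"
    unfolding is_edge_def using flat_eq[of as L]
    by (intro exI[of _ "form_indices as L"]) (auto simp: form_indices_def)
qed

lemma dense_edgesD: "E \<in> dense_edges as \<Longrightarrow> flat as E"
  by (simp add: dense_edges_def is_edge_iff)

lemma finite_dense_edges_lam: "finite (dense_edges_lam as lam)"
  by (rule finite_subset[OF _ finite_flats[of as]]) (auto simp: dense_edges_lam_def dest: dense_edgesD)

lemma mem_hyp_add: "u \<in> hyp a \<Longrightarrow> (\<lambda>j. u j + v j) \<in> hyp a \<longleftrightarrow> v \<in> hyp a"
  by (simp add: hyp_def distrib_left sum.distrib)

lemma flat_mem_add:
  assumes "flat as L" "u \<in> L"
  shows "(\<lambda>j. u j + v j) \<in> L \<longleftrightarrow> v \<in> L"
proof -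
  obtain S where L: "L = (\<Inter>i\<in>S. hyp (as ! i))" using assms(1) by (auto simp: flat_def)
  then show ?thesis using assms(2) by (auto simp: mem_hyp_add)
qed

lemma flat_csubspace:
  assumes "flat as L"
  shows "csubspace L"
proof -
  obtain S where L: "L = (\<Inter>i\<in>S. hyp (as ! i))" using assms by (auto simp: flat_def)
  have "(\<lambda>j. c * x j) \<in> hyp a" if "x \<in> hyp a" for c x and a :: "'a \<Rightarrow> complex"
  proof -
    have "(\<Sum>j\<in>UNIV. a j * (c * x j)) = c * (\<Sum>j\<in>UNIV. a j * x j)"
      unfolding sum_distrib_left by (simp add: mult_ac)
    then show ?thesis using that by (simp add: hyp_def)
  qed
  then show ?thesis
    unfolding csubspace_def L by (auto simp: mem_hyp_add) (simp add: hyp_def)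
qed

lemma hyp_nontrivial:
  assumes "a \<noteq> (\<lambda>_. 0)"
  shows "hyp a \<noteq> UNIV"
proof
  assume "hyp a = UNIV"
  have "a i = 0" for i
  proof -
    have "(\<lambda>j. if j = i then 1 else 0) \<in> hyp a" by (simp add: \<open>hyp a = UNIV\<close>)
    then show ?thesis by (simp add: hyp_def if_distrib[where f = "(*) _"] cong: if_cong)
  qed
  then show False using assms by auto
qed

lemma edge_neq_UNIV:
  assumes "\<forall>a\<in>set as. a \<noteq> (\<lambda>_. 0)" "is_edge as L"
  shows "L \<noteq> UNIV"
proof -
  obtain i where i: "i < length as" "L \<subseteq> hyp (as ! i)"
    using assms(2) by (auto simp: is_edge_iff form_indices_def)
  then have "hyp (as ! i) \<noteq> UNIV" using assms(1) by (intro hyp_nontrivial) simp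
  then show ?thesis using i by auto
qed

lemma derivation_prod_0:
  assumes "derivation d" "\<And>i. i \<in> I \<Longrightarrow> d (y i) = 0"
  shows "d (\<Prod>i\<in>I. y i) = 0"
  using assms(2)
  by (induction I rule: infinite_finite_induct)
    (simp_all add: derivation_1[OF assms(1)] derivation_mult[OF assms(1)])

lemma ddir_local_eq:
  assumes "v \<in> L"
  shows "ddir v (local_eq as L) = 0"
  unfolding local_eq_def
proof (rule derivation_prod_0[OF derivation_ddir])
  fix i assume "i \<in> form_indices as L"
  then have "v \<in> hyp (as ! i)" using assms by (auto simp: form_indices_def)
  then show "ddir v (linform (as ! i)) = 0" by (simp add: ddir_linform_dot mem_hyp_iff mconst_0)
qed

lemma local_eq_split:
  assumes "L \<subseteq> L'"
  shows "local_eq as L = local_eq as L' * (\<Prod>i\<in>form_indices as L - form_indices as L'. linform (as ! i))"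
  unfolding local_eq_def
  by (subst prod.subset_diff[OF form_indices_antimono[OF assms]])
    (simp_all add: finite_form_indices mult.commute)

section \<open>Bounding the multiplicities by induction over the flats\<close>

text \<open>Requiring all members to contain L makes L comparable with each of them, so that a dense
  L can be inserted. For L = {} this requirement is empty and the sets counted by
  \<open>m_lam\<close> remain.\<close>

definition adjacent_family ::
    "('n::finite \<Rightarrow> complex) list \<Rightarrow> complex \<Rightarrow> ('n \<Rightarrow> complex) set \<Rightarrow> ('n \<Rightarrow> complex) set set \<Rightarrow> bool" where
  "adjacent_family as lam L S \<longleftrightarrow> S \<subseteq> dense_edges_lam as lam \<and> (\<forall>E\<in>S. L \<subseteq> E) \<and>
     (\<forall>E\<in>S. \<forall>E'\<in>S. E \<noteq> E' \<longrightarrow> strongly_adjacent as E E')"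

text \<open>One polynomial b serves all z, while the family may change with z. Here z is a root in
  the variable s, hence the sign in the exponential.\<close>

definition local_bound :: "('n::finite \<Rightarrow> complex) list \<Rightarrow> ('n \<Rightarrow> complex) set \<Rightarrow> bool" where
  "local_bound as L \<longleftrightarrow> (\<exists>b. b \<noteq> 0 \<and>
     (mpoly_of_spoly b, 0) \<in> fsmod (range ddir) (mvar None) (local_eq as L) \<and>
     (\<forall>z. \<exists>S. adjacent_family as (exp (2 * of_real pi * \<i> * z)) L S \<and> order z b \<le> card S))"

section \<open>Strongly adjacent families\<close>

lemma adjacent_family_finite: "adjacent_family as lam L S \<Longrightarrow> finite S"
  by (rule finite_subset[OF _ finite_dense_edges_lam[of as lam]]) (simp add: adjacent_family_def)

lemma adjacent_family_mono: "adjacent_family as lam L' S \<Longrightarrow> L \<subseteq> L' \<Longrightarrow> adjacent_family as lam L S"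
  unfolding adjacent_family_def by blast

lemma strongly_adjacent_sym: "strongly_adjacent as E E' \<Longrightarrow> strongly_adjacent as E' E"
  unfolding strongly_adjacent_def by (auto simp: Int_commute)

lemma adjacent_family_insert:
  assumes "adjacent_family as lam L S" "L \<in> dense_edges_lam as lam"
  shows "adjacent_family as lam L (insert L S)"
  using assms unfolding adjacent_family_def strongly_adjacent_def by blast

text \<open>For E above U and F above V, the intersection of E and F is decomposed by F and E
  themselves, so it is not dense and the pair is strongly adjacent. The families are disjoint
  because a flat containing both U and V is the whole space.\<close>

lemma adjacent_family_Un:
  assumes nonzero: "\<forall>a\<in>set as. a \<noteq> (\<lambda>_. 0)"
    and L: "L \<subseteq> U" "L \<subseteq> V"
    and sum: "{(\<lambda>j. u j + v j) | u v. u \<in> U \<and> v \<in> V} = UNIV"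
    and pull: "\<And>i. i < length as \<Longrightarrow> L \<subseteq> hyp (as ! i) \<Longrightarrow> U \<subseteq> hyp (as ! i) \<or> V \<subseteq> hyp (as ! i)"
    and S: "adjacent_family as lam U S" "adjacent_family as lam V T"
  shows "adjacent_family as lam L (S \<union> T)" "S \<inter> T = {}"
proof -
  have UNIV: "E = UNIV" if "flat as E" "U \<subseteq> E" "V \<subseteq> E" for E
  proof (intro equalityI subsetI UNIV_I)
    fix x :: "'a \<Rightarrow> complex"
    obtain u v where x: "x = (\<lambda>j. u j + v j)" "u \<in> U" "v \<in> V" using sum by blast
    then show "x \<in> E" using flat_mem_add[OF that(1), of u v] that by auto
  qed
  have proper: "\<not> (U \<subseteq> E \<and> V \<subseteq> E)" if "E \<in> dense_edges as" for E
    using UNIV[of E] that edge_neq_UNIV[OF nonzero, of E] dense_edgesD[OF that]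
    by (auto simp: dense_edges_def)
  have dense: "S \<subseteq> dense_edges as" "T \<subseteq> dense_edges as"
    using S by (auto simp: adjacent_family_def dense_edges_lam_def)
  have sup: "\<And>E. E \<in> S \<Longrightarrow> U \<subseteq> E" "\<And>E. E \<in> T \<Longrightarrow> V \<subseteq> E"
    using S by (auto simp: adjacent_family_def)
  show "S \<inter> T = {}" using proper dense sup by blast
  have adj: "strongly_adjacent as E F" if "E \<in> S" "F \<in> T" for E F
  proof -
    have EF: "flat as E" "flat as F" "U \<subseteq> E" "V \<subseteq> F"
      using that dense sup dense_edgesD by blast+
    have "decomposable_at as (E \<inter> F)"
      unfolding decomposable_at_def
    proof (rule exI[of _ F], rule exI[of _ E], intro conjI allI impI)
      show "csubspace F" "csubspace E"
        using flat_csubspace EF by blast+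
      show "E \<inter> F \<subset> F" "E \<inter> F \<subset> E"
        using proper[of E] proper[of F] that dense EF by blast+
      show "F \<inter> E = E \<inter> F" by blast
      show "{(\<lambda>j. u j + v j) | u v. u \<in> F \<and> v \<in> E} = UNIV"
      proof (intro equalityI subsetI UNIV_I)
        fix x :: "'a \<Rightarrow> complex"
        obtain u v where x: "x = (\<lambda>j. u j + v j)" "u \<in> U" "v \<in> V" using sum by blast
        then have "x = (\<lambda>j. v j + u j)" by (simp add: add.commute)
        then show "x \<in> {(\<lambda>j. u j + v j) | u v. u \<in> F \<and> v \<in> E}" using x EF by blast
      qed
      fix i assume i: "i < length as" "E \<inter> F \<subseteq> hyp (as ! i)"
      \<comment> \<open>If U lies in the hyperplane, so does E: for x = u + v in E, u is in U and
        hence in E, so v lies in both E and V, therefore in E and F, therefore in the hyperplane.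
        The other case is symmetric.\<close>
      have cover: "A \<subseteq> hyp (as ! i)"
        if A: "flat as A" and B: "X \<subseteq> A" "X \<subseteq> hyp (as ! i)" "Y \<inter> A \<subseteq> E \<inter> F"
          and XY: "\<And>x. \<exists>u\<in>X. \<exists>v\<in>Y. x = (\<lambda>j. u j + v j)" for A X Y
      proof
        fix x assume "x \<in> A"
        obtain u v where x: "x = (\<lambda>j. u j + v j)" "u \<in> X" "v \<in> Y" using XY by blast
        then have "v \<in> A" using flat_mem_add[OF A, of u v] B \<open>x \<in> A\<close> by auto
        then have "v \<in> hyp (as ! i)" using x B i by blast
        then show "x \<in> hyp (as ! i)" using x B mem_hyp_add[of u "as ! i" v] by auto
      qed
      have UV: "\<exists>u\<in>U. \<exists>v\<in>V. x = (\<lambda>j. u j + v j)" for x using sum by blast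
      have VU: "\<exists>u\<in>V. \<exists>v\<in>U. x = (\<lambda>j. u j + v j)" for x
        using UV[of x] by (metis add.commute)
      have "L \<subseteq> hyp (as ! i)" using i EF L by blast
      then show "F \<subseteq> hyp (as ! i) \<or> E \<subseteq> hyp (as ! i)"
        using pull[OF i(1)] cover[of E U V] cover[of F V U] UV VU EF by blast
    qed
    then show ?thesis by (simp add: strongly_adjacent_def dense_edges_def)
  qed
  show "adjacent_family as lam L (S \<union> T)"
    unfolding adjacent_family_def
  proof (intro conjI ballI impI)
    show "S \<union> T \<subseteq> dense_edges_lam as lam" using S by (simp add: adjacent_family_def)
    show "L \<subseteq> E" if "E \<in> S \<union> T" for E using that sup[of E] L by auto
    show "strongly_adjacent as E F" if "E \<in> S \<union> T" "F \<in> S \<union> T" "E \<noteq> F" for E F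
      using that adj[of E F] strongly_adjacent_sym[OF adj[of F E]] S
      unfolding adjacent_family_def by auto
  qed
qed

lemma local_bound_decomposable:
  assumes nonzero: "\<forall>a\<in>set as. a \<noteq> (\<lambda>_. 0)"
    and dec: "decomposable_at as L"
    and IH: "\<And>L'. flat as L' \<Longrightarrow> L \<subset> L' \<Longrightarrow> local_bound as L'"
  shows "local_bound as L"
proof -
  obtain U V where UV: "L \<subset> U" "L \<subset> V"
    and sum: "{(\<lambda>j. u j + v j) | u v. u \<in> U \<and> v \<in> V} = UNIV"
    and pull: "\<And>i. i < length as \<Longrightarrow> L \<subseteq> hyp (as ! i) \<Longrightarrow> U \<subseteq> hyp (as ! i) \<or> V \<subseteq> hyp (as ! i)"
    using dec unfolding decomposable_at_def by blast
  \<comment> \<open>U and V are arbitrary subspaces. The smallest flats containing them have the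
    same vanishing forms and are still larger than L, so the induction hypothesis applies to
    them.\<close>
  define closure where "closure X = (\<Inter>i\<in>form_indices as X. hyp (as ! i))" for X
  have closure: "flat as (closure X)" "X \<subseteq> closure X" "form_indices as (closure X) = form_indices as X" for X
    unfolding closure_def by (auto simp: form_indices_def intro!: flatI)
  have eqs: "local_eq as (closure X) = local_eq as X" for X
    by (simp add: local_eq_def closure)
  have bound: "local_bound as (closure X)" if "L \<subset> X" for X
    by (rule IH[OF closure(1) psubset_subset_trans[OF that closure(2)]])
  obtain b1 where b1: "b1 \<noteq> 0"
    "(mpoly_of_spoly b1, 0) \<in> fsmod (range ddir) (mvar None) (local_eq as U)"
    "\<forall>z. \<exists>S. adjacent_family as (exp (2 * of_real pi * \<i> * z)) (closure U) S \<and> order z b1 \<le> card S"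
    using bound[OF UV(1)] unfolding local_bound_def eqs by (elim exE conjE)
  obtain b2 where b2: "b2 \<noteq> 0"
    "(mpoly_of_spoly b2, 0) \<in> fsmod (range ddir) (mvar None) (local_eq as V)"
    "\<forall>z. \<exists>S. adjacent_family as (exp (2 * of_real pi * \<i> * z)) (closure V) S \<and> order z b2 \<le> card S"
    using bound[OF UV(2)] unfolding local_bound_def eqs by (elim exE conjE)
  have "form_indices as U \<inter> form_indices as V = {}"
  proof (rule ccontr)
    assume "form_indices as U \<inter> form_indices as V \<noteq> {}"
    then obtain i where i: "i < length as" "U \<subseteq> hyp (as ! i)" "V \<subseteq> hyp (as ! i)"
      by (auto simp: form_indices_def)
    have "x \<in> hyp (as ! i)" for x
    proof -
      obtain u v where "x = (\<lambda>j. u j + v j)" "u \<in> U" "v \<in> V" using sum by blast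
      then show ?thesis using i mem_hyp_add[of u "as ! i" v] by auto
    qed
    then show False using hyp_nontrivial[of "as ! i"] nonzero i(1) by auto
  qed
  moreover have "form_indices as L = form_indices as U \<union> form_indices as V"
    using pull UV by (auto simp: form_indices_def)
  ultimately have f: "local_eq as L = local_eq as U * local_eq as V"
    unfolding local_eq_def by (simp add: prod.union_disjoint finite_form_indices)
  \<comment> \<open>The local equation at X is constant along X, so derivatives in a complementary Y
    suffice. With Y = V for X = U and conversely, the operators for one factor kill the other
    factor, as \<open>fsmod_product\<close> demands.\<close>
  have drop: "(g, k) \<in> fsmod (ddir ` Y) (mvar None) (local_eq as X)"
    if mem: "(g, k) \<in> fsmod (range ddir) (mvar None) (local_eq as X)"
      and XY: "\<And>w. \<exists>u\<in>X. \<exists>v\<in>Y. w = (\<lambda>j. v j + u j)" for X Y g k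
    using mem
  proof (rule fsmod_drop_annihilators[rotated 2])
    show "derivation d" if "d \<in> ddir ` Y" for d using that derivation_ddir by auto
    fix d' :: "'a mpoly \<Rightarrow> 'a mpoly" assume "d' \<in> range ddir"
    then obtain w where w: "d' = ddir w" by blast
    obtain u v where uv: "u \<in> X" "v \<in> Y" "w = (\<lambda>j. v j + u j)" using XY by blast
    show "\<exists>d\<in>ddir ` Y. \<exists>e. derivation e \<and> e (local_eq as X) = 0 \<and> e (mvar None) = 0 \<and>
        (\<forall>d\<in>ddir ` Y. \<forall>p. e (d p) = d (e p)) \<and> (\<forall>p. d' p = d p + e p)"
      using uv
      by (intro bexI[of _ "ddir v"] exI[of _ "ddir u"])
        (auto simp: w derivation_ddir ddir_local_eq ddir_mvar_None ddir_add_dir intro: ddir_commute)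
  qed
  have UVsum: "\<exists>u\<in>U. \<exists>v\<in>V. w = (\<lambda>j. v j + u j)" "\<exists>v\<in>V. \<exists>u\<in>U. w = (\<lambda>j. u j + v j)" for w
  proof -
    obtain u v where "w = (\<lambda>j. u j + v j)" "u \<in> U" "v \<in> V" using sum by blast
    moreover from this have "w = (\<lambda>j. v j + u j)" by (simp add: add.commute)
    ultimately show "\<exists>u\<in>U. \<exists>v\<in>V. w = (\<lambda>j. v j + u j)" "\<exists>v\<in>V. \<exists>u\<in>U. w = (\<lambda>j. u j + v j)"
      by blast+
  qed
  have "(mpoly_of_spoly b1 * mpoly_of_spoly b2, 0) \<in> fsmod (range ddir) (mvar None) (local_eq as U * local_eq as V)"
  proof (rule fsmod_product[where ?D1.0 = "ddir ` V" and ?D2.0 = "ddir ` U"])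
    show "(mpoly_of_spoly b1, 0) \<in> fsmod (ddir ` V) (mvar None) (local_eq as U)"
      by (rule drop[OF b1(2) UVsum(1)])
    show "(mpoly_of_spoly b2, 0) \<in> fsmod (ddir ` U) (mvar None) (local_eq as V)"
      by (rule drop[OF b2(2) UVsum(2)])
  qed (auto simp: derivation_ddir ddir_local_eq ddir_mpoly_of_spoly)
  then have "(mpoly_of_spoly (b1 * b2), 0) \<in> fsmod (range ddir) (mvar None) (local_eq as L)"
    by (simp add: mpoly_of_spoly_mult f)
  moreover have "\<exists>S. adjacent_family as (exp (2 * of_real pi * \<i> * z)) L S \<and> order z (b1 * b2) \<le> card S" for z
  proof -
    let ?lam = "exp (2 * of_real pi * \<i> * z)"
    obtain S where 1: "adjacent_family as ?lam (closure U) S" "order z b1 \<le> card S" using b1(3) by blast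
    obtain T where 2: "adjacent_family as ?lam (closure V) T" "order z b2 \<le> card T" using b2(3) by blast
    have S': "adjacent_family as ?lam U S" "adjacent_family as ?lam V T"
      by (rule adjacent_family_mono[OF 1(1) closure(2)], rule adjacent_family_mono[OF 2(1) closure(2)])
    have "L \<subseteq> U" "L \<subseteq> V" using UV by auto
    note fam = adjacent_family_Un[OF nonzero this sum pull S']
    have "order z (b1 * b2) \<le> card S + card T" using b1 b2 1 2 by (simp add: order_mult)
    also have "\<dots> = card (S \<union> T)"
      using fam(2) adjacent_family_finite 1(1) 2(1) by (subst card_Un_disjoint) auto
    finally show ?thesis using fam(1) by blast
  qed
  ultimately show ?thesis unfolding local_bound_def using b1(1) b2(1) by (intro exI[of _ "b1 * b2"]) auto
qed

section \<open>Roots of the Euler factors and the eigenvalue lambda\<close>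

lemma exp_2pi_i_eq_1_iff: "exp (2 * of_real pi * \<i> * z) = 1 \<longleftrightarrow> z \<in> \<int>"
proof
  assume "z \<in> \<int>"
  then obtain k where "z = of_int k" by (auto elim: Ints_cases)
  then have "exp (2 * of_real pi * \<i> * z) = cis (2 * pi * of_int k)"
    by (simp add: cis_conv_exp mult_ac)
  then show "exp (2 * of_real pi * \<i> * z) = 1" by (simp add: cis_multiple_2pi)
next
  assume 1: "exp (2 * of_real pi * \<i> * z) = 1"
  have "exp (Re (2 * of_real pi * \<i> * z)) = 1"
    using arg_cong[OF 1, of norm] by (simp only: norm_exp_eq_Re norm_one)
  then have Im: "Im z = 0" by simp
  then have "cos (2 * pi * Re z) = 1"
    using arg_cong[OF 1, of Re] by (simp add: Re_exp)
  then obtain k :: int where "2 * pi * Re z = of_int k * 2 * pi" by (auto simp: cos_one_2pi_int)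
  then have "z = of_int k" using Im by (simp add: complex_eq_iff)
  then show "z \<in> \<int>" by simp
qed

lemma exp_2pi_i_power: "exp (2 * of_real pi * \<i> * z) ^ m = exp (2 * of_real pi * \<i> * (of_nat m * z))"
  by (simp add: exp_of_nat_mult[symmetric] mult_ac)

text \<open>Each factor has the single simple root -(r+k)/d, and these differ for different k. The
  bound on the order is uniform in T, so the unknown length of the descent leaves multiplicities
  unaffected.\<close>

lemma order_euler_factors:
  fixes d r T :: nat
  assumes "d > 0"
  defines "q \<equiv> \<Prod>k<T. [:of_nat (r + k), of_nat d :: complex:]"
  shows "q \<noteq> 0" "order z q \<le> 1" "order z q \<noteq> 0 \<Longrightarrow> of_nat d * z \<in> \<int>"
proof -
  let ?p = "\<lambda>k. [:of_nat (r + k), of_nat d :: complex:]"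
  have nz: "?p k \<noteq> 0" for k using assms(1) by simp
  then show q0: "q \<noteq> 0" unfolding q_def by (simp only: prod_zero_iff finite_lessThan) blast
  have root: "poly (?p k) z = 0 \<longleftrightarrow> of_nat d * z = - of_nat (r + k)" for k
    by (simp add: add_eq_0_iff mult.commute)
  have "order z q = (\<Sum>k<T. order z (?p k))"
    unfolding q_def by (rule order_prod) (rule nz)
  also have "\<dots> \<le> (\<Sum>k<T. if poly (?p k) z = 0 then 1 else 0)"
  proof (rule sum_mono)
    fix k
    have "order z (?p k) \<le> 1" using order_degree[OF nz[of k], of z] assms(1) by simp
    then show "order z (?p k) \<le> (if poly (?p k) z = 0 then 1 else 0)" by (auto intro: order_0I)
  qed
  also have "\<dots> = card {k\<in>{..<T}. poly (?p k) z = 0}" by (simp add: sum.If_cases Int_def)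
  also have "\<dots> \<le> Suc 0"
    unfolding root by (subst card_le_Suc0_iff_eq) auto
  finally show "order z q \<le> 1" by simp
  assume "order z q \<noteq> 0"
  then have "poly q z = 0" using order_root[of q z] by simp
  then obtain k where "poly (?p k) z = 0" unfolding q_def by (auto simp: poly_prod)
  then have "of_nat d * z = - of_nat (r + k)" by (simp only: root)
  then show "of_nat d * z \<in> \<int>" by simp
qed

lemma mpoly_of_spoly_dvd:
  assumes "p dvd b" "(c * mpoly_of_spoly p, k) \<in> fsmod D s f"
  shows "(c * mpoly_of_spoly b, k) \<in> fsmod D s f"
proof -
  obtain q where "b = p * q" using assms(1) by (rule dvdE)
  then show ?thesis
    using fsmod_scale_right[OF assms(2), of "mpoly_of_spoly q"] by (simp add: mpoly_of_spoly_mult mult.assoc)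
qed

text \<open>The p with p * b * f_L^s in the module form an ideal J, and the form is shown to lie in
  its radical. A set A of forms either spans the given one, or cuts out a flat L' larger than L;
  then localizing at L' puts a power of the product of the remaining forms into J.\<close>

lemma linform_power_mem:
  assumes i: "i \<in> form_indices as L"
    and mem: "\<And>L'. flat as L' \<Longrightarrow> L \<subset> L' \<Longrightarrow> \<exists>p. p dvd b \<and>
        (mpoly_of_spoly p, 0) \<in> fsmod (range ddir) (mvar None) (local_eq as L')"
  shows "\<exists>M. (linform (as ! i) ^ M * mpoly_of_spoly b, 0) \<in> fsmod (range ddir) (mvar None) (local_eq as L)"
proof -
  let ?I = "form_indices as L" and ?a = "\<lambda>i. linform (as ! i)"
  define J where "J = {p. (p * mpoly_of_spoly b, 0) \<in> fsmod (range ddir) (mvar None) (local_eq as L)}"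
  have J: "closed_ideal J"
    unfolding closed_ideal_def J_def
    by (auto simp: fsmod_0 distrib_right mult.assoc intro: fsmod.add fsmod.scale)
  have "\<exists>M. (linform (as ! i) * (\<Prod>i\<in>{}. ?a i)) ^ M \<in> J"
  proof (rule radical_membership[where C = ?I and A = "{}" and a = ?a, OF finite_form_indices J])
    fix A assume "{} \<subseteq> A" "A \<subseteq> {} \<union> ?I"
    then have A: "A \<subseteq> ?I" by simp
    then have finA: "finite A" using finite_form_indices finite_subset by blast
    show "(\<forall>K. closed_ideal K \<longrightarrow> ?a ` A \<subseteq> K \<longrightarrow> linform (as ! i) \<in> K) \<or>
        (\<exists>M. (\<Prod>i\<in>{} \<union> ({} \<union> ?I - A). ?a i) ^ M \<in> J)"
    proof (cases "as ! i \<in> cfun.span ((!) as ` A)")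
      case True
      have "linform (as ! i) \<in> K" if "closed_ideal K" "?a ` A \<subseteq> K" for K
        using that True finA by (intro linform_in_ideal[OF that(1), of "(!) as ` A"]) (auto simp: image_image)
      then show ?thesis by blast
    next
      case False
      \<comment> \<open>This v witnesses that the flat cut out by A is strictly larger than
        L.\<close>
      then obtain v where v: "\<And>j. j \<in> A \<Longrightarrow> dot (as ! j) v = 0" "dot (as ! i) v = 1"
        using separating_vector[of "as ! i" "(!) as ` A"] by auto
      define L' where "L' = (\<Inter>j\<in>A. hyp (as ! j))"
      have flat: "flat as L'" unfolding L'_def using A by (intro flatI) (auto simp: form_indices_def)
      have "L \<subseteq> L'" unfolding L'_def using A by (auto simp: form_indices_def)
      moreover have "v \<in> L'" unfolding L'_def using v(1) by (simp add: mem_hyp_iff)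
      moreover have "v \<notin> L" using v(2) i by (auto simp: form_indices_def mem_hyp_iff)
      ultimately have LL': "L \<subset> L'" by blast
      obtain p where p: "p dvd b" "(mpoly_of_spoly p, 0) \<in> fsmod (range ddir) (mvar None) (local_eq as L')"
        using mem[OF flat LL'] by blast
      define g where "g = (\<Prod>j\<in>?I - form_indices as L'. ?a j)"
      have "local_eq as L = local_eq as L' * g"
        unfolding g_def by (rule local_eq_split) (use LL' in auto)
      then obtain M where "(g ^ M * mpoly_of_spoly p, 0) \<in> fsmod (range ddir) (mvar None) (local_eq as L)"
        using fsmod_localize[OF _ p(2), of g] derivation_ddir by auto
      then have gM: "g ^ M \<in> J" unfolding J_def using mpoly_of_spoly_dvd[OF p(1)] by blast
      \<comment> \<open>More forms than those in A may vanish on L'. The product over the complement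
        of A still contains g as a factor, and J absorbs the rest.\<close>
      have "A \<subseteq> form_indices as L'" using A by (auto simp: L'_def form_indices_def)
      then have "(\<Prod>j\<in>?I - A. ?a j) = (\<Prod>j\<in>(?I - A) - (?I - form_indices as L'). ?a j) * g"
        unfolding g_def by (intro prod.subset_diff) (auto simp: finite_form_indices)
      then have "(\<Prod>j\<in>?I - A. ?a j) ^ M = (\<Prod>j\<in>(?I - A) - (?I - form_indices as L'). ?a j) ^ M * g ^ M"
        by (simp add: power_mult_distrib)
      then have "(\<Prod>j\<in>?I - A. ?a j) ^ M \<in> J" using closed_ideal_scale[OF J gM] by simp
      then show ?thesis by auto
    qed
  qed auto
  then show ?thesis by (simp add: J_def)
qed

lemma local_bound_dense:
  assumes nonzero: "\<forall>a\<in>set as. a \<noteq> (\<lambda>_. 0)"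
    and L: "L \<in> dense_edges as"
    and IH: "\<And>L'. flat as L' \<Longrightarrow> L \<subset> L' \<Longrightarrow> local_bound as L'"
  shows "local_bound as L"
proof -
  let ?I = "form_indices as L" and ?F = "{L'. flat as L' \<and> L \<subset> L'}"
    and ?N = "\<lambda>L. fsmod (range ddir) (mvar None) (local_eq as L)"
  have edge: "is_edge as L" using L by (simp add: dense_edges_def)
  define d where "d = mult as L"
  have d: "d = card ?I" "d > 0"
    using edge by (auto simp: d_def mult_eq_card is_edge_iff card_gt_0_iff finite_form_indices)
  have "\<exists>b. \<forall>L'\<in>?F. b L' \<noteq> 0 \<and> (mpoly_of_spoly (b L'), 0) \<in> ?N L' \<and>
      (\<forall>z. \<exists>S. adjacent_family as (exp (2 * of_real pi * \<i> * z)) L' S \<and> order z (b L') \<le> card S)"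
    by (rule bchoice) (use IH in \<open>simp add: local_bound_def\<close>)
  then obtain b where b: "\<And>L'. L' \<in> ?F \<Longrightarrow> b L' \<noteq> 0" "\<And>L'. L' \<in> ?F \<Longrightarrow> (mpoly_of_spoly (b L'), 0) \<in> ?N L'"
    "\<And>L' z. L' \<in> ?F \<Longrightarrow> \<exists>S. adjacent_family as (exp (2 * of_real pi * \<i> * z)) L' S \<and> order z (b L') \<le> card S"
    by blast
  have "finite ?F" by (rule finite_subset[OF _ finite_flats[of as]]) auto
  then have fin: "finite (b ` ?F)" by (rule finite_imageI)
  \<comment> \<open>The whole space is a flat above every edge, so the least common multiple is
    taken over a nonempty set.\<close>
  have "UNIV \<in> ?F"
    using flatI[of "{}" as] edge_neq_UNIV[OF nonzero edge] by auto
  then have ne: "b ` ?F \<noteq> {}" by blast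
  have "0 \<notin> b ` ?F"
  proof
    assume "0 \<in> b ` ?F"
    then obtain L' where L': "0 = b L'" "L' \<in> ?F" by (rule imageE)
    show False using b(1)[OF L'(2)] L'(1) by simp
  qed
  from common_multiple_max_order[OF fin ne this]
  obtain b0 where b0: "b0 \<noteq> 0" "\<forall>p\<in>b ` ?F. p dvd b0"
    "\<forall>z. \<exists>p\<in>b ` ?F. order z b0 \<le> order z p" .
  \<comment> \<open>A basis of the forms vanishing on L gives coordinates transversal to L, with
    dual directions w; its cardinality is the codimension of L.\<close>
  from euler_basis[OF finite_imageI[OF finite_form_indices, of "(!) as" as L]]
  obtain B w where B: "B \<subseteq> (!) as ` ?I" "finite B"
    "\<forall>b\<in>B. \<forall>b'\<in>B. ddir (w b) (linform b') = (if b = b' then 1 else 0)"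
    "\<forall>a\<in>(!) as ` ?I. (\<Sum>b\<in>B. linform b * ddir (w b) (linform a)) = linform a" .
  have "\<exists>T. (mpoly_of_spoly b0 * (\<Prod>k<T. of_nat d * mvar None + of_nat (card B + k)), 0) \<in> ?N L"
  proof (rule fsmod_euler_descent[where v = "\<lambda>b. ddir (w b)" and y = linform, OF B(2) _ B(3)[rule_format]])
    have E: "derivation (\<lambda>p. \<Sum>b\<in>B. linform b * ddir (w b) p)"
      by (rule derivation_lincomb) (rule derivation_ddir)
    show "(\<Sum>b\<in>B. linform b * ddir (w b) (local_eq as L)) = of_nat d * local_eq as L"
      using derivation_eigen_prod[OF E, of ?I "\<lambda>i. linform (as ! i)" "\<lambda>_. 1"] B(4)
      by (simp add: local_eq_def d(1))
    fix c assume "c \<in> B"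
    then obtain i where i: "i \<in> ?I" "c = as ! i" using B(1) by blast
    show "\<exists>M. (linform c ^ M * mpoly_of_spoly b0, 0) \<in> ?N L"
      unfolding i(2)
    proof (rule linform_power_mem[OF i(1)])
      fix L' assume "flat as L'" "L \<subset> L'"
      then have "L' \<in> ?F" by simp
      then show "\<exists>p. p dvd b0 \<and> (mpoly_of_spoly p, 0) \<in> ?N L'" using b(2) b0(2) by blast
    qed
  qed (auto simp: derivation_ddir ddir_mpoly_of_spoly ddir_mvar_None)
  then obtain T where T: "(mpoly_of_spoly b0 * (\<Prod>k<T. of_nat d * mvar None + of_nat (card B + k)), 0) \<in> ?N L" ..
  define q where "q = (\<Prod>k<T. [:of_nat (card B + k), of_nat d :: complex:])"
  note q = order_euler_factors[where r = "card B" and T = T, OF d(2), folded q_def]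
  have "(mpoly_of_spoly (b0 * q), 0) \<in> ?N L"
    using T by (simp only: q_def mpoly_of_spoly_mult mpoly_of_spoly_prod mpoly_of_spoly_linear)
  moreover have nz: "b0 * q \<noteq> 0" using b0(1) q(1) by simp
  moreover have "\<exists>S. adjacent_family as (exp (2 * of_real pi * \<i> * z)) L S \<and> order z (b0 * q) \<le> card S" for z
  proof -
    let ?lam = "exp (2 * of_real pi * \<i> * z)"
    \<comment> \<open>The flat realizing the order of \<open>b0\<close> depends on z, which is
      harmless because the family may depend on z too.\<close>
    obtain L' where L': "L' \<in> ?F" "order z b0 \<le> order z (b L')" using b0(3) by blast
    obtain S where S: "adjacent_family as ?lam L' S" "order z (b L') \<le> card S"
      using b(3)[OF L'(1), of z] by blast
    have ord: "order z (b0 * q) = order z b0 + order z q" by (rule order_mult[OF nz])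
    have SL: "adjacent_family as ?lam L S" by (rule adjacent_family_mono[OF S(1)]) (use L' in auto)
    show ?thesis
    proof (cases "order z q = 0")
      case True
      then show ?thesis using SL S(2) L'(2) ord by (intro exI[of _ S]) simp
    next
      case False
      have "?lam ^ d = 1" unfolding exp_2pi_i_power exp_2pi_i_eq_1_iff by (rule q(3)[OF False])
      then have "L \<in> dense_edges_lam as ?lam" using L by (simp add: dense_edges_lam_def d_def)
      then have fam: "adjacent_family as ?lam L (insert L S)" by (rule adjacent_family_insert[OF SL])
      \<comment> \<open>All members of S contain L', which is strictly larger than L; hence
        inserting L really adds one, matching the extra simple root.\<close>
      have "L \<notin> S" using S(1) L'(1) by (auto simp: adjacent_family_def)
      then have "card (insert L S) = Suc (card S)" using adjacent_family_finite[OF SL] by simp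
      then show ?thesis using fam S(2) L'(2) ord q(2)[of z] by (intro exI[of _ "insert L S"]) simp
    qed
  qed
  ultimately show ?thesis unfolding local_bound_def by (intro exI[of _ "b0 * q"]) simp
qed

lemma local_bound_flat:
  assumes nonzero: "\<forall>a\<in>set as. a \<noteq> (\<lambda>_. 0)"
  shows "flat as L \<Longrightarrow> local_bound as L"
proof (induction "card (form_indices as L)" arbitrary: L rule: less_induct)
  case less
  have IH: "local_bound as L'" if "flat as L'" "L \<subset> L'" for L'
    using less.hyps[of L'] less.prems that form_indices_psubset[OF less.prems that]
    by (simp add: psubset_card_mono finite_form_indices)
  consider "form_indices as L = {}" | "decomposable_at as L" | "L \<in> dense_edges as"
    using less.prems by (auto simp: dense_edges_def is_edge_iff)
  then show ?case
  proof cases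
    case 1
    \<comment> \<open>The local equation is the empty product 1, so b = 1 works with the empty
      family.\<close>
    have "(mpoly_of_spoly 1, 0) \<in> fsmod (range ddir) (mvar None) (local_eq as L)"
      using fsmod.gen[of "1 :: 'a mpoly" "range ddir" "mvar None"] by (simp add: mpoly_of_spoly_1 local_eq_def 1)
    moreover have "adjacent_family as lam L {}" for lam by (simp add: adjacent_family_def)
    moreover have "order z (1 :: complex poly) = 0" for z by (rule order_0I) simp
    ultimately show ?thesis unfolding local_bound_def
      by (intro exI[of _ 1]) auto
  next
    case 2
    then show ?thesis using local_bound_decomposable[OF nonzero _ IH] by blast
  next
    case 3
    then show ?thesis using local_bound_dense[OF nonzero _ IH] by blast
  qed
qed

text \<open>Apply the local bound to the center, the intersection of all hyperplanes, whose local
  equation is the full f; dividing b can only lower orders.\<close>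

lemma bernstein_sato_order_bound:
  assumes nonzero: "\<forall>a\<in>set as. a \<noteq> (\<lambda>_. 0)"
  shows "bernstein_sato (defeq as) \<noteq> 0"
    and "\<exists>S. adjacent_family as (exp (2 * of_real pi * \<i> * z)) {} S \<and>
           order z (bernstein_sato (defeq as)) \<le> card S"
proof -
  define L where "L = (\<Inter>i\<in>{..<length as}. hyp (as ! i))"
  have "form_indices as L = {..<length as}" by (auto simp: form_indices_def L_def)
  then have eq: "local_eq as L = defeq as"
    by (simp add: local_eq_def defeq_def prod.list_conv_set_nth atLeast0LessThan)
  have "local_bound as L" by (rule local_bound_flat[OF nonzero]) (simp add: L_def flatI)
  then obtain b where b: "b \<noteq> 0"
    "(mpoly_of_spoly b, 0) \<in> fsmod (range ddir) (mvar None) (defeq as)"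
    "\<forall>z. \<exists>S. adjacent_family as (exp (2 * of_real pi * \<i> * z)) L S \<and> order z b \<le> card S"
    unfolding local_bound_def eq by (elim exE conjE)
  have "is_b_function (defeq as) b"
    using fsmod_ddir_subset_dmod b(2) unfolding is_b_function_iff by (rule subsetD)
  note bs = bernstein_sato_dvd[OF b(1) this]
  show "bernstein_sato (defeq as) \<noteq> 0" by (rule bs(1))
  obtain S where S: "adjacent_family as (exp (2 * of_real pi * \<i> * z)) L S" "order z b \<le> card S"
    using b(3) by blast
  have "order z (bernstein_sato (defeq as)) \<le> card S"
    using dvd_imp_order_le[OF b(1) bs(2), of z] S(2) by simp
  then show "\<exists>S. adjacent_family as (exp (2 * of_real pi * \<i> * z)) {} S \<and>
      order z (bernstein_sato (defeq as)) \<le> card S"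
    using adjacent_family_mono[OF S(1) empty_subsetI] by blast
qed

section \<open>From the order bound to the theorem\<close>

lemma card_le_m_lam:
  assumes "adjacent_family as lam L S"
  shows "card S \<le> m_lam as lam"
  unfolding m_lam_def
proof (rule Max_ge)
  let ?X = "{S. S \<subseteq> dense_edges_lam as lam \<and>
      (\<forall>L\<in>S. \<forall>L'\<in>S. L \<noteq> L' \<longrightarrow> strongly_adjacent as L L')}"
  have "finite ?X" by (rule finite_subset[of _ "Pow (dense_edges_lam as lam)"])
    (auto simp: finite_dense_edges_lam)
  then show "finite (card ` ?X)" by simp
  show "card S \<in> card ` ?X" using assms by (intro imageI) (simp add: adjacent_family_def)
qed

text \<open>By Bezout, z is an integral combination of m*z and n*z.\<close>

lemma coprime_multiples_in_Ints:
  fixes z :: complex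
  assumes "of_nat m * z \<in> \<int>" "of_nat n * z \<in> \<int>" "gcd m n = 1"
  shows "z \<in> \<int>"
proof -
  have "gcd (int m) (int n) = 1" using assms(3) by (metis gcd_int_int_eq of_nat_1)
  then obtain u v where "u * int m + v * int n = 1" using bezout_int by metis
  then have "of_int (u * int m + v * int n) * z = z" by simp
  moreover have "of_int (u * int m + v * int n) * z = of_int u * (of_nat m * z) + of_int v * (of_nat n * z)"
    by (simp add: algebra_simps)
  moreover have "of_int u * (of_nat m * z) + of_int v * (of_nat n * z) \<in> \<int>"
    by (rule Ints_add[OF Ints_mult[OF Ints_of_int assms(1)] Ints_mult[OF Ints_of_int assms(2)]])
  ultimately show ?thesis by metis
qed

theorem theorem2:
  fixes as :: "('n::finite \<Rightarrow> complex) list"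
  assumes nonzero: "\<forall>a\<in>set as. a \<noteq> (\<lambda>_. 0)"
    and nonprop: "\<forall>i<length as. \<forall>j<length as. i \<noteq> j \<longrightarrow> \<not> (\<exists>c. as ! j = (\<lambda>k. c * (as ! i) k))"
  defines "b \<equiv> bernstein_sato (defeq as)"
  shows "(\<forall>\<alpha>::rat. \<alpha> > 0 \<longrightarrow>
            order (of_rat \<alpha>) (pcompose b [:0, -1:])
              \<le> m_lam as (exp (- 2 * of_real pi * \<i> * of_rat \<alpha>)))
       \<and> (\<forall>\<alpha>::complex. poly (pcompose b [:0, -1:]) \<alpha> = 0 \<longrightarrow>
            (\<exists>L\<in>dense_edges as. \<exists>k::int. \<alpha> = of_int k / of_nat (mult as L)))
       \<and> ((\<forall>L\<in>dense_edges as. \<forall>L'\<in>dense_edges as.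
              L \<noteq> L' \<and> (L \<subseteq> L' \<or> L \<inter> L' \<notin> dense_edges as) \<longrightarrow> gcd (mult as L) (mult as L') = 1)
          \<longrightarrow> (\<forall>\<alpha>::complex. poly (pcompose b [:0, -1:]) \<alpha> = 0 \<and> \<alpha> \<notin> \<int> \<longrightarrow>
                 order \<alpha> (pcompose b [:0, -1:]) = 1))"
proof -
  note nz = bernstein_sato_order_bound(1)[OF nonzero, folded b_def]
  have ord: "order \<alpha> (pcompose b [:0, -1:]) = order (- \<alpha>) b" for \<alpha>
    by (rule order_reflect[OF nz])
  have bound: "\<exists>S. adjacent_family as (exp (2 * of_real pi * \<i> * (- \<alpha>))) {} S \<and>
      order \<alpha> (pcompose b [:0, -1:]) \<le> card S" for \<alpha>
    unfolding ord using bernstein_sato_order_bound(2)[OF nonzero, folded b_def, of "- \<alpha>"] .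
  have root: "order \<alpha> (pcompose b [:0, -1:]) \<noteq> 0" if "poly (pcompose b [:0, -1:]) \<alpha> = 0" for \<alpha>
    using that nz unfolding ord by (simp add: poly_pcompose order_root)
  have lam: "E \<in> dense_edges as \<and> of_nat (mult as E) * \<alpha> \<in> \<int>"
    if "adjacent_family as (exp (2 * of_real pi * \<i> * (- \<alpha>))) {} S" "E \<in> S" for S E \<alpha>
  proof -
    have "E \<in> dense_edges_lam as (exp (2 * of_real pi * \<i> * (- \<alpha>)))"
      using that by (auto simp: adjacent_family_def)
    then have "E \<in> dense_edges as" "of_nat (mult as E) * (- \<alpha>) \<in> \<int>"
      unfolding dense_edges_lam_def exp_2pi_i_power exp_2pi_i_eq_1_iff by simp_all
    then show ?thesis by (simp add: minus_in_Ints_iff)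
  qed
  show ?thesis
  proof (intro conjI allI impI)
    fix \<alpha> :: rat
    obtain S where S: "adjacent_family as (exp (2 * of_real pi * \<i> * (- of_rat \<alpha>))) {} S"
      "order (of_rat \<alpha>) (pcompose b [:0, -1:]) \<le> card S" using bound by blast
    have "exp (2 * of_real pi * \<i> * (- of_rat \<alpha>)) = exp (- 2 * of_real pi * \<i> * of_rat \<alpha>)"
      by simp
    then show "order (of_rat \<alpha>) (pcompose b [:0, -1:]) \<le> m_lam as (exp (- 2 * of_real pi * \<i> * of_rat \<alpha>))"
      using S card_le_m_lam[OF S(1)] by simp
  next
    fix \<alpha> :: complex assume rt: "poly (pcompose b [:0, -1:]) \<alpha> = 0"
    obtain S where S: "adjacent_family as (exp (2 * of_real pi * \<i> * (- \<alpha>))) {} S"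
      "order \<alpha> (pcompose b [:0, -1:]) \<le> card S" using bound by blast
    \<comment> \<open>A root has positive order, so the bounding family has a member, and any member
      E makes \<open>mult as E\<close> times \<alpha> an integer.\<close>
    then have "S \<noteq> {}" using root[OF rt] by auto
    then obtain E where E: "E \<in> S" by blast
    then have E': "E \<in> dense_edges as" "of_nat (mult as E) * \<alpha> \<in> \<int>" using lam[OF S(1)] by blast+
    then obtain k where "of_nat (mult as E) * \<alpha> = of_int k" by (auto elim: Ints_cases)
    moreover have "mult as E \<noteq> 0"
      using E'(1) by (simp add: dense_edges_def is_edge_iff mult_eq_card finite_form_indices)
    ultimately have "\<alpha> = of_int k / of_nat (mult as E)" by (simp add: field_simps)
    then show "\<exists>L\<in>dense_edges as. \<exists>k::int. \<alpha> = of_int k / of_nat (mult as L)" using E'(1) by blast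
  next
    fix \<alpha> :: complex
    assume gcd1: "\<forall>L\<in>dense_edges as. \<forall>L'\<in>dense_edges as.
        L \<noteq> L' \<and> (L \<subseteq> L' \<or> L \<inter> L' \<notin> dense_edges as) \<longrightarrow> gcd (mult as L) (mult as L') = 1"
      and rt: "poly (pcompose b [:0, -1:]) \<alpha> = 0 \<and> \<alpha> \<notin> \<int>"
    obtain S where S: "adjacent_family as (exp (2 * of_real pi * \<i> * (- \<alpha>))) {} S"
      "order \<alpha> (pcompose b [:0, -1:]) \<le> card S" using bound by blast
    \<comment> \<open>Two distinct members would have coprime multiplicities, both clearing the
      denominator of \<alpha>, which would force \<alpha> to be an integer. So the family has at
      most one member.\<close>
    have "E = E'" if "E \<in> S" "E' \<in> S" for E E'
    proof (rule ccontr)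
      assume "E \<noteq> E'"
      then have "strongly_adjacent as E E'" using S(1) that by (auto simp: adjacent_family_def)
      \<comment> \<open>Strong adjacency is symmetric whereas the assumption mentions one inclusion
        only; the other one is covered by exchanging the arguments of \<open>gcd\<close>.\<close>
      then have "gcd (mult as E) (mult as E') = 1"
        using gcd1 lam[OF S(1) that(1)] lam[OF S(1) that(2)] \<open>E \<noteq> E'\<close>
        unfolding strongly_adjacent_def by (metis gcd.commute)
      then have "\<alpha> \<in> \<int>"
        using lam[OF S(1) that(1)] lam[OF S(1) that(2)]
        by (intro coprime_multiples_in_Ints[of "mult as E" \<alpha> "mult as E'"]) simp_all
      then show False using rt by blast
    qed
    then have "card S \<le> 1"
      using adjacent_family_finite[OF S(1)] by (simp add: card_le_Suc0_iff_eq)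
    then show "order \<alpha> (pcompose b [:0, -1:]) = 1" using S(2) root rt by fastforce
  qed
qed

end
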